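(* Let $G$ be a locally countable quasi-pmp Borel graph on a standard probability space $(X,\mu)$ and let $\hat\mu$ be a lift of $\mu$ to a finite Borel measure on $G$. The following are equivalent: (I) $G$ is $\mu$-hyperfinite. (II) $\mathrm{hvp}_\mu(G)=0$. (III) $\mathrm{hep}_{\hat\mu}(G)=0$. (IV) $\mathrm{fep}_{\hat\mu}(G)=0$. These statements are implied by the following one, and are equivalent to it when $G$ is locally finite: (V) $\mathrm{fvp}_\mu(G)=0$.
   Context: A graph on $X$ is a symmetric subset of $X^2$; it is locally countable (locally finite) if every vertex has countably (finitely) many neighbors. $E_G$ is the equivalence relation of lying in the same $G$-connected component. $G$ is quasi-pmp if every Borel bijection $\gamma:X\to X$ with graph contained in $E_G$ maps $\mu$-null sets to $\mu$-null sets ($\mu$ a Borel probability measure). A graph is component-finite if all its connected components are finite. A Borel graph $G$ is hyperfinite if $E_G$ is an increasing union of countably many Borel equivalence relations with finite classes; it is $\mu$-hyperfinite if $E_G$ restricted to some $\mu$-conull $E_G$-invariant Borel set is hyperfinite. A set $V\subseteq X$ is a finitizing (resp. hyperfinitizing) vertex-cut for $G$ if $G\cap (X\setminus V)^2$ is component-finite (resp. hyperfinite). A subgraph $H\subseteq G$ is a finitizing (resp. hyperfinitizing) edge-cut for $G$ if $G\setminus H$ is component-finite (resp. hyperfinite). $\mathrm{fvp}_\mu(G)$ (resp. $\mathrm{hvp}_\mu(G)$) is the infimum of $\mu(V)$ over Borel finitizing (resp. hyperfinitizing) vertex-cuts $V$ for $G$. For a finite Borel measure $\nu$ on the set $G$,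 $\mathrm{fep}_\nu(G)$ (resp. $\mathrm{hep}_\nu(G)$) is the infimum of $\nu(H)$ over Borel finitizing (resp. hyperfinitizing) edge-cuts $H\subseteq G$. A Borel measure $\hat\mu$ on $G$ is a lift of $\mu$ if for every Borel (symmetric) subgraph $H\subseteq G$, $H$ is $\hat\mu$-null if and only if its projection $\mathrm{proj}_1(H)\subseteq X$ to the first coordinate is $\mu$-null. *)

theory Defs
  imports "HOL-Probability.Probability"
begin

text \<open>
  A standard Borel space X is a type of class \<^class>\<open>polish_space\<close> with its Borel sets; a
  graph on X is a symmetric relation (loops are allowed). The Borel sets of the product type
  are those of the product sigma-algebra, by \<open>borel_prod\<close>.
\<close>

definition borel_graph :: "('a::polish_space \<times> 'a) set \<Rightarrow> bool" where
  "borel_graph G \<longleftrightarrow> sym G \<and> G \<in> sets borel"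

definition locally_countable_graph :: "('a \<times> 'a) set \<Rightarrow> bool" where
  "locally_countable_graph G \<longleftrightarrow> (\<forall>x. countable (G `` {x}))"

definition locally_finite_graph :: "('a \<times> 'a) set \<Rightarrow> bool" where
  "locally_finite_graph G \<longleftrightarrow> (\<forall>x. finite (G `` {x}))"

text \<open>For symmetric \<open>G\<close>, the relation \<open>G\<^sup>*\<close> is an equivalence relation on all of X.\<close>

definition conn_rel :: "('a \<times> 'a) set \<Rightarrow> ('a \<times> 'a) set" where
  "conn_rel G = G\<^sup>*"

definition component_finite :: "('a \<times> 'a) set \<Rightarrow> bool" where
  "component_finite G \<longleftrightarrow> (\<forall>x. finite (conn_rel G `` {x}))"

definition hyperfinite_on :: "'a::polish_space set \<Rightarrow> ('a \<times> 'a) set \<Rightarrow> bool" where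
  "hyperfinite_on Y E \<longleftrightarrow>
     (\<exists>F :: nat \<Rightarrow> ('a \<times> 'a) set.
        incseq F \<and>
        (\<forall>n. equiv Y (F n) \<and> F n \<in> sets borel \<and> (\<forall>x\<in>Y. finite (F n `` {x}))) \<and>
        (\<Union>n. F n) = E)"

definition hyperfinite_graph :: "('a::polish_space \<times> 'a) set \<Rightarrow> bool" where
  "hyperfinite_graph G \<longleftrightarrow> hyperfinite_on UNIV (conn_rel G)"

definition mu_hyperfinite :: "'a::polish_space measure \<Rightarrow> ('a \<times> 'a) set \<Rightarrow> bool" where
  "mu_hyperfinite \<mu> G \<longleftrightarrow>
     (\<exists>Y. Y \<in> sets borel \<and> emeasure \<mu> (- Y) = 0 \<and> conn_rel G `` Y \<subseteq> Y \<and>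
          hyperfinite_on Y (conn_rel G \<inter> Y \<times> Y))"

text \<open>
  Below, null sets that are not assumed to be Borel (images and projections) are sets
  contained in a Borel null set, i.e. null sets of the completion.
\<close>

definition quasi_pmp :: "'a::polish_space measure \<Rightarrow> ('a \<times> 'a) set \<Rightarrow> bool" where
  "quasi_pmp \<mu> G \<longleftrightarrow>
     (\<forall>\<gamma> :: 'a \<Rightarrow> 'a. \<gamma> \<in> borel \<rightarrow>\<^sub>M borel \<and> bij \<gamma> \<and> (\<forall>x. (x, \<gamma> x) \<in> conn_rel G) \<longrightarrow>
        (\<forall>N \<in> null_sets (completion \<mu>). \<gamma> ` N \<in> null_sets (completion \<mu>)))"

definition borel_measure_on :: "('a::polish_space \<times> 'a) set \<Rightarrow> ('a \<times> 'a) measure \<Rightarrow> bool" where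
  "borel_measure_on G \<nu> \<longleftrightarrow> sets \<nu> = sets (restrict_space borel G)"

definition is_lift ::
    "'a::polish_space measure \<Rightarrow> ('a \<times> 'a) set \<Rightarrow> ('a \<times> 'a) measure \<Rightarrow> bool" where
  "is_lift \<mu> G \<nu> \<longleftrightarrow>
     borel_measure_on G \<nu> \<and>
     (\<forall>H. borel_graph H \<and> H \<subseteq> G \<longrightarrow>
        (H \<in> null_sets \<nu> \<longleftrightarrow> fst ` H \<in> null_sets (completion \<mu>)))"

text \<open>
  Deleting the vertices of \<open>V\<close> leaves a graph on all of X in which they are isolated.
\<close>

definition finitizing_vertex_cut :: "('a \<times> 'a) set \<Rightarrow> 'a set \<Rightarrow> bool" where
  "finitizing_vertex_cut G V \<longleftrightarrow> component_finite (G \<inter> (- V) \<times> (- V))"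

definition hyperfinitizing_vertex_cut :: "('a::polish_space \<times> 'a) set \<Rightarrow> 'a set \<Rightarrow> bool" where
  "hyperfinitizing_vertex_cut G V \<longleftrightarrow> hyperfinite_graph (G \<inter> (- V) \<times> (- V))"

definition finitizing_edge_cut :: "('a \<times> 'a) set \<Rightarrow> ('a \<times> 'a) set \<Rightarrow> bool" where
  "finitizing_edge_cut G H \<longleftrightarrow> sym H \<and> H \<subseteq> G \<and> component_finite (G - H)"

definition hyperfinitizing_edge_cut ::
    "('a::polish_space \<times> 'a) set \<Rightarrow> ('a \<times> 'a) set \<Rightarrow> bool" where
  "hyperfinitizing_edge_cut G H \<longleftrightarrow> sym H \<and> H \<subseteq> G \<and> hyperfinite_graph (G - H)"

definition fvp :: "'a::polish_space measure \<Rightarrow> ('a \<times> 'a) set \<Rightarrow> ennreal" where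
  "fvp \<mu> G = (INF V \<in> {V. V \<in> sets borel \<and> finitizing_vertex_cut G V}. emeasure \<mu> V)"

definition hvp :: "'a::polish_space measure \<Rightarrow> ('a \<times> 'a) set \<Rightarrow> ennreal" where
  "hvp \<mu> G = (INF V \<in> {V. V \<in> sets borel \<and> hyperfinitizing_vertex_cut G V}. emeasure \<mu> V)"

definition fep :: "('a::polish_space \<times> 'a) measure \<Rightarrow> ('a \<times> 'a) set \<Rightarrow> ennreal" where
  "fep \<nu> G = (INF H \<in> {H. H \<in> sets borel \<and> finitizing_edge_cut G H}. emeasure \<nu> H)"

definition hep :: "('a::polish_space \<times> 'a) measure \<Rightarrow> ('a \<times> 'a) set \<Rightarrow> ennreal" where
  "hep \<nu> G = (INF H \<in> {H. H \<in> sets borel \<and> hyperfinitizing_edge_cut G H}. emeasure \<nu> H)"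

end

(*
  Null sets can be discarded throughout, so the Lusin-Novikov theorem is replaced by
  inner regularity: up to null sets a Borel set is sigma-compact, and images and composites of
  sigma-compact relations are sigma-compact, hence Borel. The measure-theoretic core is that a
  countable-to-one continuous map is injective on a compact set of positive measure; applied to
  both projections of G with respect to the lifted measure, it yields Borel matchings inside G, and
  quasi-invariance under the involutions they define shows that the G-saturation of a null set is
  null.
  The implications then run (I) -> (II) -> (III) -> (IV) -> (I) and (V) -> (IV). Small vertex cuts give
  small edge cuts because the set of edges meeting a null set is null for the lift. Cutting the edges
  outside the n-th finite equivalence relation turns hyperfinitizing cuts into finitizing ones. For
  finitizing edge cuts H_n with summable measures, the components of the graphs
  G - (H_n Un H_{n+1} Un ...) are finite and increase, off the saturation of the null set limsup H_n,
  to those of G. If G is locally finite, the sets of vertices with an edge outside the n-th finite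
  equivalence relation decrease to a null set, so (I) implies (V).
*)

theory Submission
  imports Defs
begin

section \<open>Perfect compact sets, sigma-compact sets and inner regularity\<close>

text \<open>Without isolated points every singleton is closed with empty interior in
  \<open>S\<close>. If \<open>S\<close> were countable, the Baire category theorem in the compact
  Hausdorff space \<open>S\<close> would give \<open>S\<close> empty interior in itself.\<close>

lemma uncountable_compact_without_isolated_points:
  fixes S :: "'a::metric_space set"
  assumes "compact S" "S \<noteq> {}"
    and "\<And>x U. x \<in> S \<Longrightarrow> open U \<Longrightarrow> x \<in> U \<Longrightarrow> \<exists>y\<in>S \<inter> U. y \<noteq> x"
  shows "uncountable S"
proof
  assume "countable S"
  let ?X = "top_of_set S"
  have "?X interior_of \<Union>((\<lambda>x. {x}) ` S) = {}"
  proof (rule Baire_category_alt)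
    have "compact_space ?X" "Hausdorff_space ?X"
      using assms(1) by (auto simp: compact_space_subtopology Hausdorff_space_subtopology)
    then show "completely_metrizable_space ?X \<or> locally_compact_space ?X \<and> regular_space ?X"
      using compact_Hausdorff_or_regular_imp_normal_space compact_imp_locally_compact_space
        compact_Hausdorff_imp_regular_space by blast
    show "countable ((\<lambda>x. {x}) ` S)"
      using \<open>countable S\<close> by simp
  next
    fix T assume "T \<in> (\<lambda>x. {x}) ` S"
    then obtain x where x: "x \<in> S" "T = {x}" by blast
    have "W = {}" if "openin ?X W" "W \<subseteq> {x}" for W
    proof (rule ccontr)
      assume "W \<noteq> {}"
      with that have "W = {x}" by blast
      with that(1) obtain U where "open U" "{x} = S \<inter> U"
        by (auto simp: openin_open)
      with assms(3)[of x U] x(1) show False by blast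
    qed
    then have "?X interior_of T = {}"
      unfolding x(2) interior_of_def by blast
    moreover have "closedin ?X T"
      using x by simp
    ultimately show "closedin ?X T \<and> ?X interior_of T = {}" by blast
  qed
  moreover have "\<Union>((\<lambda>x. {x}) ` S) = S" by auto
  ultimately show False
    using assms(2) by (metis interior_of_topspace topspace_euclidean_subtopology)
qed

text \<open>A countable family instead of a sequence makes the empty set and countable unions
  immediate.\<close>

definition sigma_compact :: "'a::topological_space set \<Rightarrow> bool" where
  "sigma_compact S \<longleftrightarrow> (\<exists>\<C>. countable \<C> \<and> (\<forall>K\<in>\<C>. compact K) \<and> S = \<Union>\<C>)"

lemma sigma_compact_compact: "compact K \<Longrightarrow> sigma_compact K"
  unfolding sigma_compact_def by (rule exI[of _ "{K}"]) auto

lemma sigma_compact_Union: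
  assumes "countable \<A>" "\<And>S. S \<in> \<A> \<Longrightarrow> sigma_compact S"
  shows "sigma_compact (\<Union>\<A>)"
proof -
  obtain \<C> where \<C>: "\<And>S. S \<in> \<A> \<Longrightarrow> countable (\<C> S) \<and> (\<forall>K\<in>\<C> S. compact K) \<and> S = \<Union>(\<C> S)"
    using assms(2) unfolding sigma_compact_def by metis
  then have "countable (\<Union>(\<C> ` \<A>)) \<and> (\<forall>K\<in>\<Union>(\<C> ` \<A>). compact K) \<and> \<Union>\<A> = \<Union>(\<Union>(\<C> ` \<A>))"
    using assms(1) by (intro conjI) (auto, blast+)
  then show ?thesis
    unfolding sigma_compact_def by blast
qed

lemma sigma_compact_Un: "sigma_compact S \<Longrightarrow> sigma_compact T \<Longrightarrow> sigma_compact (S \<union> T)"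
  using sigma_compact_Union[of "{S, T}"] by auto

lemma sigma_compact_image:
  assumes "sigma_compact S" "continuous_on UNIV f"
  shows "sigma_compact (f ` S)"
proof -
  obtain \<C> where \<C>: "countable \<C>" "\<forall>K\<in>\<C>. compact K" "S = \<Union>\<C>"
    using assms(1) unfolding sigma_compact_def by blast
  have "sigma_compact (\<Union>((`) f ` \<C>))"
    using \<C> assms(2)
    by (intro sigma_compact_Union)
      (auto intro!: sigma_compact_compact compact_continuous_image continuous_on_subset[OF assms(2)])
  also have "\<Union>((`) f ` \<C>) = f ` S"
    using \<C>(3) by blast
  finally show ?thesis .
qed

lemma sigma_compact_borel:
  fixes S :: "'a::t2_space set"
  assumes "sigma_compact S" shows "S \<in> sets borel"
proof -
  obtain \<C> where \<C>: "countable \<C>" "\<forall>K\<in>\<C>. compact K" "S = \<Union>\<C>"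
    using assms unfolding sigma_compact_def by blast
  then show ?thesis
    unfolding \<C>(3) by (intro sets.countable_Union) (auto intro: borel_compact)
qed

text \<open>For compact \<open>K\<close> and \<open>L\<close>, the composite \<open>K O L\<close> is
  a continuous image of the set of pairs in \<open>K \<times> L\<close> whose middle coordinates
  agree. That set is compact because the diagonal of a Hausdorff space is closed. Composition
  distributes over countable unions.\<close>

lemma sigma_compact_relcomp:
  fixes R :: "('a::t2_space \<times> 'b::t2_space) set" and S :: "('b \<times> 'c::t2_space) set"
  assumes "sigma_compact R" "sigma_compact S"
  shows "sigma_compact (R O S)"
proof -
  obtain \<C> where \<C>: "countable \<C>" "\<forall>K\<in>\<C>. compact K" "R = \<Union>\<C>"
    using assms(1) unfolding sigma_compact_def by blast
  obtain \<D> where \<D>: "countable \<D>" "\<forall>K\<in>\<D>. compact K" "S = \<Union>\<D>"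
    using assms(2) unfolding sigma_compact_def by blast
  have "sigma_compact (K O L)" if "compact K" "compact L" for K :: "('a \<times> 'b) set" and L :: "('b \<times> 'c) set"
  proof -
    let ?D = "{p :: ('a \<times> 'b) \<times> ('b \<times> 'c). snd (fst p) = fst (snd p)}"
    have "closed ?D"
      by (intro closed_Collect_eq continuous_intros)
    then have "compact ((K \<times> L) \<inter> ?D)"
      using that by (intro compact_Int_closed compact_Times)
    then have "sigma_compact ((\<lambda>p. (fst (fst p), snd (snd p))) ` ((K \<times> L) \<inter> ?D))"
      by (intro sigma_compact_image sigma_compact_compact continuous_intros)
    also have "(\<lambda>p. (fst (fst p), snd (snd p))) ` ((K \<times> L) \<inter> ?D) = K O L"
      by (force simp: image_iff)
    finally show ?thesis .
  qed
  then have "sigma_compact (\<Union>((\<lambda>(K, L). K O L) ` (\<C> \<times> \<D>)))"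
    using \<C> \<D> by (intro sigma_compact_Union) auto
  also have "\<Union>((\<lambda>(K, L). K O L) ` (\<C> \<times> \<D>)) = R O S"
    unfolding \<C>(3) \<D>(3) by auto
  finally show ?thesis .
qed

lemma inner_regular_compact:
  fixes m :: "'a::{second_countable_topology, complete_space} measure"
  assumes "finite_measure m" "sets m = sets borel" "B \<in> sets borel" "c < emeasure m B"
  obtains K where "compact K" "K \<subseteq> B" "c < emeasure m K"
proof -
  interpret finite_measure m by fact
  have "c < (SUP K \<in> {K. K \<subseteq> B \<and> compact K}. emeasure m K)"
    using inner_regular[OF assms(2) _ assms(3)] assms(4) by simp
  then show ?thesis
    using that by (auto simp: less_SUP_iff)
qed

text \<open>The union of compact subsets of \<open>B\<close> missing at most mass
  \<open>1 / Suc n\<close> each has full measure in \<open>B\<close>.\<close>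

lemma sigma_compact_inner:
  fixes m :: "'a::{second_countable_topology, complete_space} measure"
  assumes "finite_measure m" "sets m = sets borel" "B \<in> sets borel"
  obtains S where "sigma_compact S" "S \<subseteq> B" "emeasure m (B - S) = 0"
proof -
  interpret finite_measure m by fact
  have "\<exists>K. compact K \<and> K \<subseteq> B \<and> emeasure m B \<le> emeasure m K + ennreal (1 / Suc n)" for n
  proof (cases "emeasure m B = 0")
    \<comment> \<open>For a null \<open>B\<close> the strict inequality that drives the other case
      fails, so the empty set is taken.\<close>
    case True
    then show ?thesis by (intro exI[of _ "{}"]) auto
  next
    case False
    then have "emeasure m B - ennreal (1 / Suc n) < emeasure m B"
      by (intro ennreal_between) (auto simp: zero_less_iff_neq_zero less_top[symmetric])
    from inner_regular_compact[OF assms this] obtain K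
      where "compact K" "K \<subseteq> B" "emeasure m B - ennreal (1 / Suc n) < emeasure m K" .
    then show ?thesis
      by (intro exI[of _ K]) (auto simp: add.commute dest!: less_imp_le simp: ennreal_minus_le_iff)
  qed
  then obtain K where K: "\<And>n. compact (K n)" "\<And>n. K n \<subseteq> B"
    "\<And>n. emeasure m B \<le> emeasure m (K n) + ennreal (1 / Suc n)"
    by metis
  let ?S = "\<Union>n. K n"
  have S: "sigma_compact ?S"
    using K(1) by (intro sigma_compact_Union) (auto intro: sigma_compact_compact)
  have Sm [measurable]: "?S \<in> sets m" "B \<in> sets m"
    using sigma_compact_borel[OF S] assms by auto
  have "emeasure m (B - ?S) \<le> ennreal (1 / Suc n)" for n
  proof -
    have Kn [measurable]: "K n \<in> sets m"
      using sigma_compact_borel[OF sigma_compact_compact[OF K(1)]] assms(2) by auto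
    have "emeasure m (B - ?S) \<le> emeasure m (B - K n)"
      by (intro emeasure_mono) auto
    also have "\<dots> = emeasure m B - emeasure m (K n)"
      using K(2) by (intro emeasure_Diff) auto
    also have "\<dots> \<le> ennreal (1 / Suc n)"
      using K(3)[of n] by (simp add: ennreal_minus_le_iff)
    finally show ?thesis .
  qed
  moreover have "(\<lambda>n. ennreal (1 / Suc n)) \<longlonglongrightarrow> ennreal 0"
    by (intro tendsto_ennrealI) real_asymp
  ultimately have "emeasure m (B - ?S) \<le> ennreal 0"
    by (intro LIMSEQ_le_const[of "\<lambda>n. ennreal (1 / Suc n)"]) auto
  then show ?thesis
    using that[OF S] K(2) by auto
qed

section \<open>Countable-to-one continuous maps\<close>

text \<open>The set \<open>C\<close> is the zero set of the Radon-Nikodym derivative between the images under \<open>f\<close>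
  of the measures restricted to \<open>B\<close> and to \<open>A\<close>.\<close>

lemma pushforward_vanishing_set:
  fixes f :: "'a \<Rightarrow> 'b"
  assumes fm: "finite_measure m" and [measurable]: "f \<in> m \<rightarrow>\<^sub>M N" "A \<in> sets m" "B \<in> sets m"
    and BA: "B \<subseteq> A"
  obtains C where "C \<in> sets N" "emeasure m (B \<inter> f -` C) = 0"
    "\<And>D. D \<in> sets N \<Longrightarrow> D \<inter> C = {} \<Longrightarrow> emeasure m (B \<inter> f -` D) = 0 \<Longrightarrow> emeasure m (A \<inter> f -` D) = 0"
proof -
  interpret finite_measure m by fact
  define \<nu> where "\<nu> S = distr (density m (indicator S)) N f" for S
  have \<nu>: "emeasure (\<nu> S) D = emeasure m (S \<inter> f -` D)" if [measurable]: "S \<in> sets m" "D \<in> sets N" for S D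
  proof -
    have "emeasure (\<nu> S) D = (\<integral>\<^sup>+x. indicator S x * indicator (f -` D \<inter> space m) x \<partial>m)"
      by (simp add: \<nu>_def emeasure_distr emeasure_density)
    also have "\<dots> = (\<integral>\<^sup>+x. indicator (S \<inter> (f -` D \<inter> space m)) x \<partial>m)"
      by (intro nn_integral_cong) (auto simp: indicator_def)
    also have "\<dots> = emeasure m (S \<inter> (f -` D \<inter> space m))"
      by (rule nn_integral_indicator) measurable
    also have "S \<inter> (f -` D \<inter> space m) = S \<inter> f -` D"
      using sets.sets_into_space[OF that(1)] by blast
    finally show ?thesis .
  qed
  have sp: "space (\<nu> S) = space N" "sets (\<nu> S) = sets N" for S
    by (auto simp: \<nu>_def)
  interpret \<nu>A: finite_measure "\<nu> A"
    by (rule finite_measureI) (simp add: \<nu> sp)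
  have "absolutely_continuous (\<nu> A) (\<nu> B)"
    unfolding absolutely_continuous_def
  proof
    fix D assume "D \<in> null_sets (\<nu> A)"
    then have D [measurable]: "D \<in> sets N" and "emeasure m (A \<inter> f -` D) = 0"
      by (auto simp: sp \<nu> null_sets_def)
    moreover have "A \<inter> f -` D \<in> sets m"
    proof -
      have "A \<inter> f -` D = A \<inter> (f -` D \<inter> space m)"
        using sets.sets_into_space[OF assms(3)] by blast
      then show ?thesis by (metis assms(2,3) D measurable_sets sets.Int)
    qed
    ultimately have "emeasure m (B \<inter> f -` D) = 0"
      using BA emeasure_eq_0[of "A \<inter> f -` D" m "B \<inter> f -` D"] by blast
    then show "D \<in> null_sets (\<nu> B)"
      by (simp add: null_sets_def \<nu> sp)
  qed
  from \<nu>A.Radon_Nikodym[OF this] obtain g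
    where g [measurable]: "g \<in> borel_measurable (\<nu> A)" and dg: "density (\<nu> A) g = \<nu> B"
    by (auto simp: sp)
  have gN [measurable]: "g \<in> borel_measurable N"
    using g by (simp add: measurable_cong_sets[OF sp(2) refl])
  have int: "emeasure (\<nu> B) D = (\<integral>\<^sup>+y. g y * indicator D y \<partial>\<nu> A)" if "D \<in> sets N" for D
    using that by (simp add: dg[symmetric] emeasure_density sp)
  define C where "C = {y \<in> space N. g y = 0}"
  have C [measurable]: "C \<in> sets N"
    unfolding C_def by measurable
  show ?thesis
  proof (rule that[OF C])
    have "emeasure (\<nu> B) C = (\<integral>\<^sup>+y. 0 \<partial>\<nu> A)"
      unfolding int[OF C] by (intro nn_integral_cong) (auto simp: C_def indicator_def)
    then show "emeasure m (B \<inter> f -` C) = 0"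
      by (simp add: \<nu>)
  next
    fix D assume D [measurable]: "D \<in> sets N" and disj: "D \<inter> C = {}" and 0: "emeasure m (B \<inter> f -` D) = 0"
    have [measurable]: "D \<in> sets (\<nu> A)" by (simp add: sp)
    have "(\<integral>\<^sup>+y. g y * indicator D y \<partial>\<nu> A) = 0"
      using 0 int[OF D] by (simp add: \<nu>)
    then have "AE y in \<nu> A. g y * indicator D y = 0"
      by (subst (asm) nn_integral_0_iff_AE) auto
    \<comment> \<open>\<open>D\<close> misses the zero set \<open>C\<close> of \<open>g\<close>, so
      the integrand can vanish only outside \<open>D\<close>.\<close>
    then have "AE y in \<nu> A. y \<notin> D"
      using AE_space by eventually_elim
        (use disj in \<open>auto simp: C_def sp indicator_def split: if_splits\<close>)
    then have "emeasure (\<nu> A) D = 0"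
      by (subst (asm) AE_iff_measurable[of D]) (use sets.sets_into_space[OF D] in \<open>auto simp: sp\<close>)
    then show "emeasure m (A \<inter> f -` D) = 0"
      by (simp add: \<nu>)
  qed
qed

text \<open>Suppose that \<open>f\<close> is injective only on null sets. Deleting from every basic open \<open>U\<close> the points
  over which \<open>U\<close> carries no conditional mass leaves compact fibres, almost all of which have no
  isolated points and are therefore uncountable. The set \<open>T U\<close> consists of the values over which
  \<open>U\<close> carries mass but no two disjoint basic subsets of \<open>U\<close> both do.\<close>

lemma countable_to_one_imp_injective_on_compact:
  fixes m :: "'a::{second_countable_topology, complete_space} measure" and f :: "'a \<Rightarrow> 'b::t2_space"
  assumes fm: "finite_measure m" and sets_m: "sets m = sets borel"
    and cont: "continuous_on UNIV f" and cA: "compact A" and pos: "emeasure m A \<noteq> 0"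
    and fib: "\<And>y. countable {x \<in> A. f x = y}"
  shows "\<exists>B. compact B \<and> B \<subseteq> A \<and> emeasure m B \<noteq> 0 \<and> inj_on f B"
proof (rule ccontr)
  assume neg: "\<not> (\<exists>B. compact B \<and> B \<subseteq> A \<and> emeasure m B \<noteq> 0 \<and> inj_on f B)"
  interpret finite_measure m by fact
  \<comment> \<open>By inner regularity the negated claim extends from compact to Borel sets:
    \<open>f\<close> is injective only on null Borel subsets of \<open>A\<close>.\<close>
  have inj0: "emeasure m B = 0" if "B \<in> sets borel" "B \<subseteq> A" "inj_on f B" for B
  proof (rule ccontr)
    assume "emeasure m B \<noteq> 0"
    then have "0 < emeasure m B" by (simp add: zero_less_iff_neq_zero)
    from inner_regular_compact[OF fm sets_m that(1) this] obtain K
      where "compact K" "K \<subseteq> B" "0 < emeasure m K" .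
    moreover from this that have "K \<subseteq> A" "inj_on f K"
      by (auto intro: inj_on_subset)
    ultimately show False
      using neg by auto
  qed
  have [measurable]: "f \<in> m \<rightarrow>\<^sub>M borel"
    using borel_measurable_continuous_onI[OF cont] by (simp add: measurable_cong_sets[OF sets_m refl])
  have vim: "f -` D \<in> sets m" if "D \<in> sets borel" for D
    using measurable_sets[OF borel_measurable_continuous_onI[OF cont] that] sets_m by simp
  have [measurable]: "A \<in> sets m"
    using cA sets_m by (auto intro: borel_compact)
  obtain \<U> :: "'a set set" where \<U>: "countable \<U>" "topological_basis \<U>"
    using ex_countable_basis by blast
  have \<U>_open: "open U" if "U \<in> \<U>" for U
    using topological_basis_open[OF \<U>(2) that] .
  have \<U>_sets: "U \<in> sets m" if "U \<in> \<U>" for U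
    using \<U>_open[OF that] sets_m by auto
  \<comment> \<open>The last clause is used repeatedly below: to show that a Borel set of values
    disjoint from \<open>C U\<close> is negligible for \<open>A\<close>, it suffices to show this
    for the part of \<open>A\<close> in \<open>U\<close>.\<close>
  have "\<forall>U\<in>\<U>. \<exists>C. C \<in> sets borel \<and> emeasure m (A \<inter> U \<inter> f -` C) = 0 \<and>
      (\<forall>D \<in> sets borel. D \<inter> C = {} \<longrightarrow> emeasure m (A \<inter> U \<inter> f -` D) = 0 \<longrightarrow> emeasure m (A \<inter> f -` D) = 0)"
  proof
    fix U assume "U \<in> \<U>"
    then have [measurable]: "U \<in> sets m" by (rule \<U>_sets)
    obtain C where "C \<in> sets borel" "emeasure m (A \<inter> U \<inter> f -` C) = 0"
      "\<And>D. D \<in> sets borel \<Longrightarrow> D \<inter> C = {} \<Longrightarrow> emeasure m (A \<inter> U \<inter> f -` D) = 0 \<Longrightarrow> emeasure m (A \<inter> f -` D) = 0"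
      using pushforward_vanishing_set[of m f borel A "A \<inter> U"] fm by (auto simp del: vimage_Int)
    then show "\<exists>C. C \<in> sets borel \<and> emeasure m (A \<inter> U \<inter> f -` C) = 0 \<and>
      (\<forall>D \<in> sets borel. D \<inter> C = {} \<longrightarrow> emeasure m (A \<inter> U \<inter> f -` D) = 0 \<longrightarrow> emeasure m (A \<inter> f -` D) = 0)"
      by blast
  qed
  then obtain C where C: "\<And>U. U \<in> \<U> \<Longrightarrow> C U \<in> sets borel"
      and C0: "\<And>U. U \<in> \<U> \<Longrightarrow> emeasure m (A \<inter> U \<inter> f -` C U) = 0"
      and C1: "\<And>U D. U \<in> \<U> \<Longrightarrow> D \<in> sets borel \<Longrightarrow> D \<inter> C U = {} \<Longrightarrow>
        A \<inter> U \<inter> f -` D \<in> null_sets m \<Longrightarrow> A \<inter> f -` D \<in> null_sets m"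
    using vim \<U>_sets by (simp add: bchoice_iff null_sets_def) (metis \<open>A \<in> sets m\<close> sets.Int)
  define A' where "A' = A - (\<Union>U\<in>\<U>. A \<inter> U \<inter> f -` C U)"
  have N: "(\<Union>U\<in>\<U>. A \<inter> U \<inter> f -` C U) \<in> null_sets m"
    using \<U>(1) C0 C vim \<U>_sets by (intro null_sets_UN') (auto simp: null_sets_def)
  have A'_sets [measurable]: "A' \<in> sets m"
    unfolding A'_def using N by auto
  have A'D: "f x \<notin> C U" if "x \<in> A'" "U \<in> \<U>" "x \<in> U" for x U
    using that unfolding A'_def by blast
  have A'_sub: "A' \<subseteq> A" by (auto simp: A'_def)
  have AA': "A - A' \<in> null_sets m"
  proof (rule null_sets_subset[OF N])
    show "A - A' \<in> sets m" by measurable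
  qed (auto simp: A'_def)
  define T where "T U = - C U - (\<Union>(V, W)\<in>{(V, W)\<in>\<U> \<times> \<U>. V \<subseteq> U \<and> W \<subseteq> U \<and> V \<inter> W = {}}. - (C V \<union> C W))" for U
  have T: "A \<inter> f -` T U \<in> null_sets m" if U: "U \<in> \<U>" for U
  proof (rule C1[OF U])
    have "countable {(V, W)\<in>\<U> \<times> \<U>. V \<subseteq> U \<and> W \<subseteq> U \<and> V \<inter> W = {}}"
      by (rule countable_subset[of _ "\<U> \<times> \<U>"]) (use \<U>(1) in auto)
    then show TU: "T U \<in> sets borel"
      unfolding T_def using C U by (intro sets.Diff sets.countable_UN') auto
    show "T U \<inter> C U = {}" by (auto simp: T_def)
    have meas: "A \<inter> U \<inter> f -` T U \<in> sets m" "A' \<inter> U \<inter> f -` T U \<in> sets m"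
      using vim[OF TU] \<U>_sets[OF U] A'_sets \<open>A \<in> sets m\<close> by blast+
    \<comment> \<open>Two points of one fibre could be separated by disjoint basic sets
      \<open>V\<close> and \<open>W\<close> inside \<open>U\<close>. As both points survive in
      \<open>A'\<close>, the common value lies outside \<open>C V\<close> and \<open>C W\<close>,
      which \<open>T U\<close> forbids.\<close>
    have "inj_on f (A' \<inter> U \<inter> f -` T U)"
    proof (rule inj_onI, rule ccontr)
      fix x x' assume x: "x \<in> A' \<inter> U \<inter> f -` T U" and x': "x' \<in> A' \<inter> U \<inter> f -` T U"
        and eq: "f x = f x'" and "x \<noteq> x'"
      then obtain O1 O2 where O: "open O1" "open O2" "x \<in> O1" "x' \<in> O2" "O1 \<inter> O2 = {}"
        by (metis hausdorff)
      have "open (O1 \<inter> U)" "open (O2 \<inter> U)" using O \<U>_open[OF U] by auto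
      moreover have "x \<in> O1 \<inter> U" "x' \<in> O2 \<inter> U" using O x x' by auto
      ultimately obtain V W where VW: "V \<in> \<U>" "x \<in> V" "V \<subseteq> O1 \<inter> U" "W \<in> \<U>" "x' \<in> W" "W \<subseteq> O2 \<inter> U"
        by (meson topological_basisE[OF \<U>(2)])
      then have "f x \<in> C V \<union> C W"
      proof -
        have "(V, W) \<in> {(V, W)\<in>\<U> \<times> \<U>. V \<subseteq> U \<and> W \<subseteq> U \<and> V \<inter> W = {}}"
          using VW O(5) by blast
        moreover have "f x \<in> T U" using x by blast
        ultimately show ?thesis unfolding T_def by blast
      qed
      moreover have "f x \<notin> C V" "f x' \<notin> C W"
        using A'D x x' VW by blast+
      ultimately show False using eq by simp
    qed
    then have "A' \<inter> U \<inter> f -` T U \<in> null_sets m"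
      using inj0[of "A' \<inter> U \<inter> f -` T U"] meas A'_sub sets_m by (simp add: null_setsI le_infI1)
    then have "(A - A') \<union> A' \<inter> U \<inter> f -` T U \<in> null_sets m"
      by (rule null_sets.Un[OF AA'])
    then show "A \<inter> U \<inter> f -` T U \<in> null_sets m"
      by (rule null_sets_subset) (use meas in blast)+
  qed
  \<comment> \<open>Replacing \<open>A' \<inter> U\<close> by a sigma-compact set of full measure
    makes its image Borel. The set \<open>R U\<close> then consists of the values outside
    \<open>C U\<close> over which \<open>S U\<close> has no point, and is negligible for
    \<open>A\<close>.\<close>
  have "\<forall>U\<in>\<U>. \<exists>S. sigma_compact S \<and> S \<subseteq> A' \<inter> U \<and> emeasure m (A' \<inter> U - S) = 0"
    using sigma_compact_inner[OF fm sets_m] \<U>_sets sets_m A'_sets by (metis sets.Int)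
  then obtain S where S: "\<And>U. U \<in> \<U> \<Longrightarrow> sigma_compact (S U)" "\<And>U. U \<in> \<U> \<Longrightarrow> S U \<subseteq> A' \<inter> U"
      "\<And>U. U \<in> \<U> \<Longrightarrow> emeasure m (A' \<inter> U - S U) = 0"
    by metis
  define R where "R U = - C U - f ` S U" for U
  have R: "A \<inter> f -` R U \<in> null_sets m" if U: "U \<in> \<U>" for U
  proof (rule C1[OF U])
    show RU: "R U \<in> sets borel"
      unfolding R_def using C[OF U] sigma_compact_borel[OF sigma_compact_image[OF S(1)[OF U] cont]] by auto
    show "R U \<inter> C U = {}" by (auto simp: R_def)
    have "A' \<inter> U - S U \<in> sets m"
      using sigma_compact_borel[OF S(1)[OF U]] sets_m \<U>_sets[OF U]
      by (intro sets.Diff sets.Int A'_sets) auto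
    then have "(A - A') \<union> (A' \<inter> U - S U) \<in> null_sets m"
      using S(3)[OF U] by (intro null_sets.Un[OF AA'] null_setsI)
    moreover have "A \<inter> U \<inter> f -` R U \<in> sets m"
      using vim[OF RU] \<U>_sets[OF U] by (intro sets.Int \<open>A \<in> sets m\<close>)
    ultimately show "A \<inter> U \<inter> f -` R U \<in> null_sets m"
      by (rule null_sets_subset) (auto simp: R_def)
  qed
  let ?Bad = "(A - A') \<union> (\<Union>U\<in>\<U>. (A \<inter> f -` T U) \<union> (A \<inter> f -` R U))"
  have "?Bad \<in> null_sets m"
    using \<U>(1) T R AA' by (intro null_sets.Un null_sets_UN') auto
  \<comment> \<open>Positivity of the measure of \<open>A\<close> yields a point \<open>x0\<close>
    whose value avoids every \<open>T U\<close> and \<open>R U\<close>. The fibre of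
    \<open>A'\<close> over this value is the perfect set sought.\<close>
  then have "\<not> A \<subseteq> ?Bad"
    using pos null_sets_subset[of ?Bad m A] by (auto simp: null_sets_def)
  then obtain x0 where x0: "x0 \<in> A'" "x0 \<in> A" "\<And>U. U \<in> \<U> \<Longrightarrow> f x0 \<notin> T U" "\<And>U. U \<in> \<U> \<Longrightarrow> f x0 \<notin> R U"
    by blast
  define y where "y = f x0"
  let ?P = "A' \<inter> f -` {y}"
  have "uncountable ?P"
  proof (rule uncountable_compact_without_isolated_points)
    have "closed (f -` {y})"
      using continuous_closed_vimage[of "{y}" f] cont by (simp add: continuous_on_eq_continuous_at)
    \<comment> \<open>Over the fixed value \<open>y\<close>, passing from \<open>A\<close> to
      \<open>A'\<close> deletes just the basic open sets \<open>U\<close> with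
      \<open>y \<in> C U\<close>, so the fibre stays compact.\<close>
    then have "compact (A \<inter> f -` {y} - \<Union>{U \<in> \<U>. y \<in> C U})"
      using cA \<U>_open by (intro compact_diff compact_Int_closed open_Union) auto
    also have "A \<inter> f -` {y} - \<Union>{U \<in> \<U>. y \<in> C U} = ?P"
      by (auto simp: A'_def)
    finally show "compact ?P" .
    show "?P \<noteq> {}" using x0 by (auto simp: y_def)
  next
    fix x O1 assume x: "x \<in> ?P" and O1: "open O1" "x \<in> O1"
    obtain U where U: "U \<in> \<U>" "x \<in> U" "U \<subseteq> O1"
      using topological_basisE[OF \<U>(2) O1] by blast
    have "y \<notin> C U" using x U by (auto simp: A'_def)
    moreover have "y \<notin> T U" using x0(3)[OF U(1)] by (simp add: y_def)
    ultimately obtain V W where VW: "V \<in> \<U>" "W \<in> \<U>" "V \<subseteq> U" "W \<subseteq> U" "V \<inter> W = {}" "y \<notin> C V" "y \<notin> C W"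
      unfolding T_def by blast
    have ex: "\<exists>z\<in>?P. z \<in> Q" if "Q \<in> \<U>" "y \<notin> C Q" for Q
    proof -
      have "y \<in> f ` S Q"
        using x0(4)[OF that(1)] that(2) unfolding R_def y_def by blast
      then show ?thesis
        using S(2)[OF that(1)] by blast
    qed
    \<comment> \<open>Two distinct points of the fibre lie in the neighbourhood \<open>U\<close> of
      \<open>x\<close>, so at least one of them differs from \<open>x\<close>.\<close>
    obtain v w where "v \<in> ?P" "v \<in> V" "w \<in> ?P" "w \<in> W"
      using ex[OF VW(1,6)] ex[OF VW(2,7)] by blast
    moreover from this VW(5) have "v \<noteq> w" by blast
    ultimately show "\<exists>z\<in>?P \<inter> O1. z \<noteq> x"
      using VW(3,4) U(3) by (metis IntI subsetD)
  qed
  moreover have "countable ?P"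
    by (rule countable_subset[OF _ fib[of y]]) (auto simp: A'_def)
  ultimately show False by blast
qed

section \<open>Null sets and quasi-invariance for a graph with a lifted measure\<close>

lemma borel_converse:
  fixes R :: "('a::polish_space \<times> 'a) set"
  assumes "R \<in> sets borel" shows "R\<inverse> \<in> sets borel"
proof -
  have "prod.swap \<in> borel \<rightarrow>\<^sub>M (borel :: ('a \<times> 'a) measure)"
    by (intro borel_measurable_continuous_onI continuous_on_swap)
  from measurable_sets[OF this assms] have "prod.swap -` R \<in> sets borel" by simp
  also have "prod.swap -` R = R\<inverse>" by auto
  finally show ?thesis .
qed

lemma closed_Id: "closed (Id :: ('a::t2_space \<times> 'a) set)"
proof -
  have "Id = {p :: 'a \<times> 'a. fst p = snd p}" by auto
  also have "closed \<dots>" by (intro closed_Collect_eq continuous_intros)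
  finally show ?thesis .
qed

lemma sym_conn_rel: "sym G \<Longrightarrow> sym (conn_rel G)"
  unfolding conn_rel_def by (rule sym_rtrancl)

lemma compact_converse:
  fixes K :: "('a::topological_space \<times> 'a) set"
  assumes "compact K" shows "compact (K\<inverse>)"
proof -
  have "K\<inverse> = prod.swap ` K" by auto
  then show ?thesis
    using assms by (simp add: compact_continuous_image continuous_on_swap)
qed

text \<open>Here \<open>m\<close> is the lift, transported from the subspace \<open>G\<close> to the whole product.\<close>

locale lifted_graph = prob_space \<mu> + finite_measure m
  for \<mu> :: "'a::polish_space measure" and m :: "('a \<times> 'a) measure" +
  fixes G :: "('a \<times> 'a) set"
  assumes sets_\<mu>: "sets \<mu> = sets borel" and sets_m: "sets m = sets borel"
    and graph: "borel_graph G" and countable_nbrs: "locally_countable_graph G"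
    and qpmp: "quasi_pmp \<mu> G"
    and lift: "\<And>H. borel_graph H \<Longrightarrow> H \<subseteq> G \<Longrightarrow>
      emeasure m H = 0 \<longleftrightarrow> fst ` H \<in> null_sets (completion \<mu>)"
begin

lemma fm: "finite_measure m"
  by unfold_locales

lemma sym_G: "sym G" and borel_G: "G \<in> sets borel"
  using graph by (auto simp: borel_graph_def)

abbreviation negl :: "'a set \<Rightarrow> bool" where
  "negl S \<equiv> S \<in> null_sets (completion \<mu>)"

lemma negl_iff: "negl S \<longleftrightarrow> (\<exists>N\<in>sets borel. emeasure \<mu> N = 0 \<and> S \<subseteq> N)"
  unfolding null_sets_completion_iff2 by (auto simp: null_sets_def sets_\<mu>)

lemma negl_subset: "negl T \<Longrightarrow> S \<subseteq> T \<Longrightarrow> negl S"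
  by (rule null_sets_completion_subset)

text \<open>Quasi-invariance is applied to the involution that swaps the endpoints of every edge in \<open>K\<close>.\<close>

lemma matching_negl:
  assumes K: "compact K" "K \<subseteq> G" and inj: "inj_on fst K" "inj_on snd K"
    and disj: "fst ` K \<inter> snd ` K = {}" and null: "negl (snd ` K)"
  shows "negl (fst ` K)"
proof -
  define \<gamma> where "\<gamma> x = (if x \<in> fst ` K then snd (the_inv_into K fst x)
      else if x \<in> snd ` K then fst (the_inv_into K snd x) else x)" for x
  have mem: "a \<in> fst ` K" "b \<in> snd ` K" if "(a, b) \<in> K" for a b
    using that by force+
  have \<gamma>1: "\<gamma> a = b" if "(a, b) \<in> K" for a b
    using the_inv_into_f_f[OF inj(1) that] mem[OF that] by (simp add: \<gamma>_def)
  have \<gamma>2: "\<gamma> b = a" if "(a, b) \<in> K" for a b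
  proof -
    \<comment> \<open>The first branch of \<open>\<gamma>\<close> takes precedence, so the
      disjointness of the two projections enters here.\<close>
    have "b \<notin> fst ` K" using mem[OF that] disj by blast
    then show ?thesis
      using the_inv_into_f_f[OF inj(2) that] mem[OF that] by (simp add: \<gamma>_def)
  qed
  have \<gamma>3: "\<gamma> x = x" if "x \<notin> fst ` K" "x \<notin> snd ` K" for x
    using that by (simp add: \<gamma>_def)
  have cases: "(\<exists>y. (x, y) \<in> K) \<or> (\<exists>y. (y, x) \<in> K) \<or> (x \<notin> fst ` K \<and> x \<notin> snd ` K)" for x
    by force
  have invol: "\<gamma> (\<gamma> x) = x" for x
    using cases[of x] \<gamma>1 \<gamma>2 \<gamma>3 by metis
  then have "bij \<gamma>"
    by (intro o_bij[of \<gamma>]) auto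
  have graph_\<gamma>: "(x, \<gamma> x) \<in> conn_rel G" for x
    using cases[of x]
  proof (elim disjE exE)
    fix y assume "(x, y) \<in> K"
    then show ?thesis using K(2) \<gamma>1 by (auto simp: conn_rel_def)
  next
    fix y assume "(y, x) \<in> K"
    moreover from this have "(x, y) \<in> G" using K(2) sym_G by (auto dest: symD)
    ultimately show ?thesis using \<gamma>2 by (auto simp: conn_rel_def)
  qed (simp add: \<gamma>3 conn_rel_def)
  have sc: "sigma_compact (K \<inter> S)" if "closed S" for S
    using K(1) that by (intro sigma_compact_compact compact_Int_closed)
  have proj: "fst ` (K \<inter> S) \<in> sets borel" "snd ` (K \<inter> S) \<in> sets borel" if "closed S" for S
    using sc[OF that] by (auto intro!: sigma_compact_borel sigma_compact_image continuous_intros)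
  note projK = proj[of UNIV, simplified]
  have "\<gamma> \<in> borel \<rightarrow>\<^sub>M borel"
    unfolding borel_eq_closed[where 'a='a]
  proof (rule measurable_measure_of)
    fix C :: "'a set" assume "C \<in> Collect closed"
    then have C: "closed C" by simp
    have "closed (UNIV \<times> C)" "closed (C \<times> UNIV)"
      using C by (auto intro!: closed_Times)
    \<comment> \<open>The preimage of a closed set splits into two projections of compact subsets of
      \<open>K\<close> and a Borel set of fixed points.\<close>
    then have "fst ` (K \<inter> UNIV \<times> C) \<union> snd ` (K \<inter> C \<times> UNIV) \<union> (C - fst ` K - snd ` K) \<in> sets borel"
      using proj projK C by (intro sets.Un sets.Diff) auto
    also have "fst ` (K \<inter> UNIV \<times> C) \<union> snd ` (K \<inter> C \<times> UNIV) \<union> (C - fst ` K - snd ` K) = \<gamma> -` C"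
    proof (rule set_eqI)
      fix x
      consider y where "(x, y) \<in> K" | y where "(y, x) \<in> K" | "x \<notin> fst ` K" "x \<notin> snd ` K"
        using cases by blast
      then show "x \<in> fst ` (K \<inter> UNIV \<times> C) \<union> snd ` (K \<inter> C \<times> UNIV) \<union> (C - fst ` K - snd ` K) \<longleftrightarrow> x \<in> \<gamma> -` C"
      proof cases
        case 1
        then have "x \<in> fst ` K" "x \<notin> snd ` (K \<inter> C \<times> UNIV)" using mem disj by blast+
        moreover have "x \<in> fst ` (K \<inter> UNIV \<times> C) \<longleftrightarrow> y \<in> C"
          using 1 inj(1) by (force simp: inj_on_def image_iff)
        ultimately show ?thesis using \<gamma>1[OF 1] by simp
      next
        case 2
        then have "x \<in> snd ` K" "x \<notin> fst ` (K \<inter> UNIV \<times> C)" using mem disj by blast+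
        moreover have "x \<in> snd ` (K \<inter> C \<times> UNIV) \<longleftrightarrow> y \<in> C"
          using 2 inj(2) by (force simp: inj_on_def image_iff)
        ultimately show ?thesis using \<gamma>2[OF 2] by simp
      next
        case 3
        then show ?thesis using \<gamma>3[OF 3] by auto
      qed
    qed
    finally show "\<gamma> -` C \<inter> space (sigma UNIV (Collect closed)) \<in> sets (sigma UNIV (Collect closed))"
      by (simp add: borel_eq_closed[symmetric])
  qed auto
  with \<open>bij \<gamma>\<close> graph_\<gamma> qpmp null have "negl (\<gamma> ` snd ` K)"
    unfolding quasi_pmp_def by blast
  moreover have "\<gamma> ` snd ` K = fst ` K"
    using \<gamma>2 by (force simp: image_iff)
  ultimately show ?thesis by simp
qed

lemma countable_fibres:
  assumes "K \<subseteq> G" shows "countable {p \<in> K. fst p = y}" "countable {p \<in> K. snd p = y}"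
proof -
  have "countable (G `` {y})"
    using countable_nbrs by (simp add: locally_countable_graph_def)
  then have "countable (Pair y ` (G `` {y}))" "countable ((\<lambda>x. (x, y)) ` (G `` {y}))"
    by auto
  moreover have "{p \<in> K. fst p = y} \<subseteq> Pair y ` (G `` {y})"
    "{p \<in> K. snd p = y} \<subseteq> (\<lambda>x. (x, y)) ` (G `` {y})"
    using assms sym_G by (auto simp: image_iff sym_def)
  ultimately show "countable {p \<in> K. fst p = y}" "countable {p \<in> K. snd p = y}"
    by (auto intro: countable_subset)
qed

text \<open>Local countability makes both projections countable-to-one on \<open>G\<close>. The
  injectivity result is applied to \<open>fst\<close> on a compact subset of \<open>L\<close>, and
  then to \<open>snd\<close> on the compact set so obtained.\<close>

lemma positive_matching:
  assumes L: "L \<in> sets borel" "L \<subseteq> G" "emeasure m L \<noteq> 0"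
  obtains K where "compact K" "K \<subseteq> L" "emeasure m K \<noteq> 0" "inj_on fst K" "inj_on snd K"
proof -
  have "0 < emeasure m L" using L(3) by (simp add: zero_less_iff_neq_zero)
  from inner_regular_compact[OF fm sets_m L(1) this] obtain K0
    where K0: "compact K0" "K0 \<subseteq> L" "0 < emeasure m K0" .
  have c: "continuous_on UNIV (fst :: 'a \<times> 'a \<Rightarrow> 'a)" "continuous_on UNIV (snd :: 'a \<times> 'a \<Rightarrow> 'a)"
    by (intro continuous_intros)+
  obtain K1 where K1: "compact K1" "K1 \<subseteq> K0" "emeasure m K1 \<noteq> 0" "inj_on fst K1"
    using countable_to_one_imp_injective_on_compact[OF fm sets_m c(1) K0(1) _ countable_fibres(1)] K0 L(2)
    by (metis less_irrefl order.trans)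
  obtain K2 where "compact K2" "K2 \<subseteq> K1" "emeasure m K2 \<noteq> 0" "inj_on snd K2"
    using countable_to_one_imp_injective_on_compact[OF fm sets_m c(2) K1(1,3) countable_fibres(2)] K0 K1 L(2)
    by (metis order.trans)
  with K0 K1 show ?thesis
    by (intro that[of K2]) (auto intro: inj_on_subset)
qed

text \<open>Let \<open>D\<close> be the set of edges leading into a Borel null set \<open>Z'\<close>
  from outside. A matching of positive measure in \<open>D\<close> or its converse would have one
  null projection, hence two by \<open>matching_negl\<close>, and its symmetrization would be null
  by the lift property. So \<open>D\<close> and its converse are null, and the lift property in the
  other direction makes their projections null.\<close>

lemma negl_neighbours:
  assumes "negl Z" shows "negl (G `` Z)"
proof -
  obtain Z' where Z': "Z' \<in> sets borel" "emeasure \<mu> Z' = 0" "Z \<subseteq> Z'"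
    using assms by (auto simp: negl_iff)
  then have nZ': "negl Z'" by (auto simp: negl_iff)
  define D where "D = G \<inter> (- Z') \<times> Z'"
  have D: "D \<in> sets borel"
    unfolding D_def using borel_G Z'(1) by (intro sets.Int borel_Times) auto
  have sub: "D \<subseteq> G" "D\<inverse> \<subseteq> G"
    using sym_G by (auto simp: D_def sym_def)
  \<comment> \<open>Both orientations are treated, since the measure \<open>m\<close> need not be
    symmetric.\<close>
  have key: "emeasure m L = 0" if L: "L = D \<or> L = D\<inverse>" for L
  proof (rule ccontr)
    assume "emeasure m L \<noteq> 0"
    then obtain K where K: "compact K" "K \<subseteq> L" "emeasure m K \<noteq> 0" "inj_on fst K" "inj_on snd K"
      using positive_matching[of L] L sub D borel_converse[OF D] by blast
    \<comment> \<open>\<open>K'\<close> is \<open>K\<close> oriented towards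
      \<open>Z'\<close>.\<close>
    obtain K' where K': "K' = K \<or> K' = K\<inverse>" "K' \<subseteq> D"
      using K(2) L by (metis converse_converse converse_mono)
    have inj: "inj_on fst K'" "inj_on snd K'"
      using K'(1) K(4,5) by (auto simp: inj_on_def; metis fst_conv snd_conv prod.inject)+
    have "compact K'" using K' K(1) compact_converse by blast
    moreover have sn: "negl (snd ` K')"
      using K'(2) by (intro negl_subset[OF nZ']) (auto simp: D_def)
    moreover have "fst ` K' \<inter> snd ` K' = {}"
    proof -
      have "fst ` K' \<subseteq> - Z'" "snd ` K' \<subseteq> Z'"
        using K'(2) by (auto simp: D_def)
      then show ?thesis by blast
    qed
    ultimately have "negl (fst ` K')"
      using K'(2) sub(1) inj by (intro matching_negl) auto
    then have "negl (fst ` K' \<union> snd ` K')" using sn by (rule null_sets.Un)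
    also have "fst ` K' \<union> snd ` K' = fst ` (K \<union> K\<inverse>)"
      using K'(1) by (force simp: image_iff)
    finally have "negl (fst ` (K \<union> K\<inverse>))" .
    moreover have "borel_graph (K \<union> K\<inverse>)"
      using K(1) compact_converse[OF K(1)] by (auto simp: borel_graph_def sym_def intro!: sets.Un borel_compact)
    moreover have "K \<union> K\<inverse> \<subseteq> G"
      using K(2) L sub by auto
    ultimately have "emeasure m (K \<union> K\<inverse>) = 0"
      using lift by blast
    moreover have "K \<union> K\<inverse> \<in> sets m"
      using K(1) compact_converse[OF K(1)] by (auto simp: sets_m intro!: sets.Un borel_compact)
    ultimately show False
      using K(3) emeasure_eq_0[of "K \<union> K\<inverse>" m K] by blast
  qed
  have "D \<in> null_sets m" "D\<inverse> \<in> null_sets m"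
    using key D borel_converse[OF D] by (auto simp: null_sets_def sets_m)
  then have "emeasure m (D \<union> D\<inverse>) = 0"
    by (metis null_sets.Un null_setsD1)
  moreover have "borel_graph (D \<union> D\<inverse>)"
    using D borel_converse[OF D] by (auto simp: borel_graph_def sym_def)
  ultimately have "negl (fst ` (D \<union> D\<inverse>))"
    using lift sub by (metis Un_least)
  with nZ' have "negl (Z' \<union> fst ` (D \<union> D\<inverse>))"
    by (rule null_sets.Un)
  moreover have "G `` Z \<subseteq> Z' \<union> fst ` (D \<union> D\<inverse>)"
  proof
    fix x assume "x \<in> G `` Z"
    then obtain z where "z \<in> Z'" "(x, z) \<in> G" using sym_G Z'(3) by (auto simp: sym_def)
    then have "x \<in> Z' \<or> (x, z) \<in> D" by (auto simp: D_def)
    then show "x \<in> Z' \<union> fst ` (D \<union> D\<inverse>)" by force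
  qed
  ultimately show ?thesis by (rule negl_subset)
qed

lemma negl_saturation:
  assumes "negl Z" shows "negl (conn_rel G `` Z)"
proof -
  have "negl ((G ^^ n) `` Z)" for n
    by (induction n) (use assms negl_neighbours in \<open>simp_all add: relcomp_Image\<close>)
  then have "negl (\<Union>n. (G ^^ n) `` Z)" by (intro null_sets_UN)
  also have "(\<Union>n. (G ^^ n) `` Z) = conn_rel G `` Z"
    unfolding conn_rel_def rtrancl_is_UN_relpow by blast
  finally show ?thesis .
qed

text \<open>Alternating saturation with passage to a Borel null superset gives null sets
  \<open>W n\<close>, each containing the saturation of the previous one. Their union is Borel, null
  and invariant, and \<open>Y\<close> is its complement.\<close>

lemma invariant_conull:
  assumes "negl Z"
  obtains Y where "Y \<in> sets borel" "emeasure \<mu> (- Y) = 0" "conn_rel G `` Y \<subseteq> Y" "Y \<inter> Z = {}"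
proof -
  have "\<exists>N\<in>sets borel. emeasure \<mu> N = 0 \<and> conn_rel G `` S \<subseteq> N" if "negl S" for S
    using negl_saturation[OF that] by (simp add: negl_iff)
  then obtain h where h: "\<And>S. negl S \<Longrightarrow> h S \<in> sets borel"
      "\<And>S. negl S \<Longrightarrow> emeasure \<mu> (h S) = 0" "\<And>S. negl S \<Longrightarrow> conn_rel G `` S \<subseteq> h S"
    by metis
  define W where "W n = (h ^^ n) Z" for n
  have W: "negl (W n)" for n
    by (induction n) (use assms h in \<open>auto simp: W_def negl_iff\<close>)
  have WS: "W (Suc n) = h (W n)" for n by (simp add: W_def)
  have W_step: "conn_rel G `` W n \<subseteq> W (Suc n)" for n
    using h(3)[OF W] by (simp add: WS)
  \<comment> \<open>The union starts at index 1 because \<open>W 0 = Z\<close> need not be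
    Borel.\<close>
  define Y where "Y = - (\<Union>n. W (Suc n))"
  show ?thesis
  proof (rule that)
    show "Y \<in> sets borel" using h(1)[OF W] by (auto simp: Y_def WS)
    have "(\<Union>n. W (Suc n)) \<in> null_sets \<mu>"
      using h(1,2)[OF W] by (intro null_sets_UN) (auto simp: WS null_sets_def sets_\<mu>)
    then show "emeasure \<mu> (- Y) = 0" by (auto simp: Y_def)
    show "conn_rel G `` Y \<subseteq> Y"
    proof (clarify, rule ccontr)
      fix y x assume y: "y \<in> Y" and "(y, x) \<in> conn_rel G" "x \<notin> Y"
      then obtain n where "x \<in> W (Suc n)" "(x, y) \<in> conn_rel G"
        using sym_conn_rel[OF sym_G] by (auto simp: Y_def sym_def)
      then have "y \<in> W (Suc (Suc n))" using W_step[of "Suc n"] by blast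
      with y show False by (auto simp: Y_def)
    qed
    have "Z \<subseteq> W (Suc 0)"
      using W_step[of 0] by (force simp: W_def conn_rel_def)
    then show "Y \<inter> Z = {}" by (auto simp: Y_def)
  qed
qed

text \<open>This replaces a Borel graph by one with a Borel connectedness relation, at the cost of a
  null set of vertices. Inner regularity leaves a null set of edges, and the lift property turns it
  into a null set of vertices.\<close>

lemma sigma_compact_subgraph:
  assumes "borel_graph R" "R \<subseteq> G"
  obtains Q where "sigma_compact Q" "Q \<subseteq> R" "sym Q" "negl (fst ` (R - Q))"
proof -
  have R: "R \<in> sets borel" "sym R" using assms(1) by (auto simp: borel_graph_def)
  obtain S where S: "sigma_compact S" "S \<subseteq> R" "emeasure m (R - S) = 0"
    using sigma_compact_inner[OF fm sets_m R(1)] .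
  define Q where "Q = S \<union> S\<inverse>"
  have "S\<inverse> = prod.swap ` S" by auto
  then have Q: "sigma_compact Q"
    unfolding Q_def using S(1) by (auto intro!: sigma_compact_Un sigma_compact_image continuous_on_swap)
  have sub: "Q \<subseteq> R" "sym Q"
    using S(2) R(2) by (auto simp: Q_def sym_def)
  have RS: "R - S \<in> sets m"
    using R(1) sigma_compact_borel[OF S(1)] sets_m by auto
  have "emeasure m (R - Q) = 0"
    by (rule emeasure_eq_0[OF RS S(3)]) (auto simp: Q_def)
  moreover have "borel_graph (R - Q)"
    using R sub sigma_compact_borel[OF Q] by (auto simp: borel_graph_def sym_def)
  ultimately have "negl (fst ` (R - Q))"
    using lift assms(2) by blast
  with Q sub that show ?thesis by blast
qed

end

section \<open>Connectedness relations and finite components\<close>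

lemma conn_rel_mono: "G \<subseteq> H \<Longrightarrow> conn_rel G \<subseteq> conn_rel H"
  unfolding conn_rel_def by (rule rtrancl_mono)

lemma component_finite_subset:
  assumes "component_finite H" "G \<subseteq> H" shows "component_finite G"
  unfolding component_finite_def
proof
  fix x
  have "conn_rel G `` {x} \<subseteq> conn_rel H `` {x}"
    using conn_rel_mono[OF assms(2)] by blast
  then show "finite (conn_rel G `` {x})"
    using assms(1) finite_subset unfolding component_finite_def by blast
qed

lemma equiv_conn_rel: "sym G \<Longrightarrow> equiv UNIV (conn_rel G)"
  unfolding conn_rel_def by (intro equivI) (auto simp: refl_rtrancl trans_rtrancl sym_rtrancl)

lemma equiv_restrict:
  assumes "equiv UNIV E" shows "equiv Y (E \<inter> Y \<times> Y)"
proof (rule equivI)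
  show "refl_on Y (E \<inter> Y \<times> Y)" "sym (E \<inter> Y \<times> Y)" "trans (E \<inter> Y \<times> Y)"
    using assms by (auto simp: equiv_def refl_on_def intro!: symI transI dest: symD transD)
qed auto

text \<open>The diagonal is added because \<open>conn_rel\<close> is reflexive on the whole space
  while \<open>F\<close> lives on \<open>Y\<close>.\<close>

lemma conn_rel_subset_equiv:
  assumes "equiv Y F" "G \<subseteq> F" shows "conn_rel G \<subseteq> F \<union> Id"
proof (rule subrelI)
  fix x y assume "(x, y) \<in> conn_rel G"
  then have "(x, y) \<in> G\<^sup>*" by (simp add: conn_rel_def)
  then show "(x, y) \<in> F \<union> Id"
    by induction (use assms in \<open>auto simp: equiv_def dest: transD\<close>)
qed

lemma finite_equiv_Image:
  assumes "equiv Y F" "\<And>x. x \<in> Y \<Longrightarrow> finite (F `` {x})" shows "finite (F `` {x})"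
proof (cases "x \<in> Y")
  case False
  have "F \<subseteq> Y \<times> Y" using assms(1) by (rule equiv_type)
  with False have "F `` {x} = {}" by blast
  then show ?thesis by simp
qed (rule assms(2))

lemma component_finite_subset_equiv:
  assumes "equiv Y F" "\<And>x. x \<in> Y \<Longrightarrow> finite (F `` {x})" "G \<subseteq> F"
  shows "component_finite G"
  unfolding component_finite_def
proof
  fix x
  have "conn_rel G `` {x} \<subseteq> F `` {x} \<union> {x}"
    using conn_rel_subset_equiv[OF assms(1,3)] by blast
  moreover have "finite (F `` {x} \<union> {x})"
    using finite_equiv_Image[OF assms(1,2)] by simp
  ultimately show "finite (conn_rel G `` {x})"
    by (rule finite_subset)
qed

text \<open>All positive powers of \<open>Q\<close> are sigma-compact. The zeroth power, the
  diagonal, need not be, but it is closed.\<close>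

lemma borel_conn_rel:
  fixes Q :: "('a::polish_space \<times> 'a) set"
  assumes "sigma_compact Q" shows "conn_rel Q \<in> sets borel"
proof -
  have "sigma_compact (Q ^^ Suc n)" for n
  proof (induction n)
    case (Suc n)
    then show ?case
      using sigma_compact_relcomp[OF Suc assms] by simp
  qed (use assms in simp)
  then have "(\<Union>n. Q ^^ Suc n) \<in> sets borel"
    by (intro sets.countable_UN) (auto intro: sigma_compact_borel)
  moreover have "conn_rel Q = Id \<union> (\<Union>n. Q ^^ Suc n)"
    unfolding conn_rel_def rtrancl_is_UN_relpow
  proof
    show "(\<Union>n. Q ^^ n) \<subseteq> Id \<union> (\<Union>n. Q ^^ Suc n)"
    proof
      fix p assume "p \<in> (\<Union>n. Q ^^ n)"
      then obtain n where "p \<in> Q ^^ n" by blast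
      then show "p \<in> Id \<union> (\<Union>n. Q ^^ Suc n)" by (cases n) auto
    qed
    show "Id \<union> (\<Union>n. Q ^^ Suc n) \<subseteq> (\<Union>n. Q ^^ n)"
      using relpow.simps(1)[of Q] by blast
  qed
  ultimately show ?thesis
    using closed_Id by (metis borel_closed sets.Un)
qed

text \<open>A path of \<open>K\<close> starting in \<open>Y\<close> stays in \<open>Y\<close> by
  invariance, and every edge of \<open>K\<close> starting in \<open>Y\<close> belongs to
  \<open>Q\<close>.\<close>

lemma conn_rel_sub_invariant:
  assumes "conn_rel G `` Y \<subseteq> Y" "K \<subseteq> G" "Y \<inter> fst ` (K - Q) = {}" "x \<in> Y" "(x, y) \<in> conn_rel K"
  shows "(x, y) \<in> conn_rel Q"
proof -
  have "(x, y) \<in> K\<^sup>*" using assms(5) by (simp add: conn_rel_def)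
  then show ?thesis
  proof induction
    case base
    show ?case by (simp add: conn_rel_def)
  next
    case (step y z)
    have "(x, y) \<in> conn_rel G"
      using step(1) rtrancl_mono[OF assms(2)] by (auto simp: conn_rel_def)
    then have "y \<in> Y" using assms(1,4) by blast
    then have "(y, z) \<in> Q"
      using assms(3) step(2) by force
    then show ?case using step(3) by (auto simp: conn_rel_def)
  qed
qed

text \<open>A path has finitely many edges, so one member of the increasing sequence contains them
  all.\<close>

lemma conn_rel_incseq_UN:
  assumes "incseq K" "(x, y) \<in> conn_rel G" "conn_rel G `` Y \<subseteq> Y" "x \<in> Y"
    and edge: "\<And>a b. a \<in> Y \<Longrightarrow> (a, b) \<in> G \<Longrightarrow> \<exists>n. (a, b) \<in> K n"
  shows "\<exists>n. (x, y) \<in> conn_rel (K n)"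
proof -
  have "(x, y) \<in> G\<^sup>*" using assms(2) by (simp add: conn_rel_def)
  then show ?thesis
  proof induction
    case base
    show ?case by (simp add: conn_rel_def)
  next
    case (step y z)
    then obtain n where n: "(x, y) \<in> conn_rel (K n)" by blast
    have "y \<in> Y" using step(1) assms(3,4) by (auto simp: conn_rel_def)
    then obtain k where k: "(y, z) \<in> K k" using edge step(2) by blast
    have "(x, y) \<in> conn_rel (K (max n k))" "(y, z) \<in> K (max n k)"
      using n k conn_rel_mono incseqD[OF assms(1), of n "max n k"] incseqD[OF assms(1), of k "max n k"]
      by (meson max.cobounded1 max.cobounded2 subsetD)+
    then show ?case by (auto simp: conn_rel_def intro: rtrancl_into_rtrancl)
  qed
qed

lemma mu_hyperfiniteE:
  assumes "mu_hyperfinite \<mu> G"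
  obtains Y F where "Y \<in> sets borel" "emeasure \<mu> (- Y) = 0" "conn_rel G `` Y \<subseteq> Y"
    "incseq F" "\<And>n. equiv Y (F n)" "\<And>n. F n \<in> sets borel"
    "\<And>n x. x \<in> Y \<Longrightarrow> finite (F n `` {x})" "(\<Union>n. F n) = conn_rel G \<inter> Y \<times> Y"
proof -
  obtain Y where Y: "Y \<in> sets borel" "emeasure \<mu> (- Y) = 0" "conn_rel G `` Y \<subseteq> Y"
    and "hyperfinite_on Y (conn_rel G \<inter> Y \<times> Y)"
    using assms unfolding mu_hyperfinite_def by blast
  then obtain F where F: "incseq F"
      "\<forall>n. equiv Y (F n) \<and> F n \<in> sets borel \<and> (\<forall>x\<in>Y. finite (F n `` {x}))"
      "(\<Union>n. F n) = conn_rel G \<inter> Y \<times> Y"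
    unfolding hyperfinite_on_def by blast
  show ?thesis
    using F(2) by (intro that[OF Y F(1) _ _ _ F(3)]) simp_all
qed

text \<open>Edges with both ends in \<open>V\<close> are included, so that deleting these edges has
  the same effect as deleting the vertices.\<close>

definition edge_boundary :: "('a \<times> 'a) set \<Rightarrow> 'a set \<Rightarrow> ('a \<times> 'a) set" where
  "edge_boundary G V = G \<inter> (V \<times> UNIV \<union> UNIV \<times> V)"

lemma Diff_edge_boundary: "G - edge_boundary G V = G \<inter> (- V) \<times> (- V)"
  by (auto simp: edge_boundary_def)

section \<open>Vanishing infima and the Borel-Cantelli lemma\<close>

lemma Inf_image_eq_0_iff: "(INF x\<in>A. f x) = (0::ennreal) \<longleftrightarrow> (\<forall>e>0. \<exists>x\<in>A. f x < e)"
  by (metis INF_less_iff less_irrefl zero_less_iff_neq_zero)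

lemma (in finite_measure) limsup_null:
  assumes "\<And>n. A n \<in> sets M" "\<And>n. emeasure M (A n) < ennreal ((1/2) ^ n)"
  shows "limsup A \<in> null_sets M"
proof (rule borel_cantelli_limsup1)
  show "emeasure M (A n) < \<infinity>" for n
    using assms(2)[of n] by (simp add: less_top[symmetric])
  show "summable (\<lambda>n. measure M (A n))"
  proof (rule summable_comparison_test)
    have "measure M (A n) \<le> (1/2) ^ n" for n
      using assms(2)[of n] by (simp add: emeasure_eq_measure ennreal_less_iff less_imp_le)
    then show "\<exists>N. \<forall>n\<ge>N. norm (measure M (A n)) \<le> (1/2) ^ n" by auto
    show "summable (\<lambda>n. (1/2::real) ^ n)" by (rule summable_geometric) simp
  qed
qed (rule assms(1))

text \<open>The tail unions decrease to the limit superior, so continuity from above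
  applies.\<close>

lemma (in finite_measure) emeasure_tail_less:
  fixes A :: "nat \<Rightarrow> 'a set"
  assumes A: "\<And>n. A n \<in> sets M" and "limsup A \<in> null_sets M" "0 < e"
  shows "\<exists>n. emeasure M (\<Union>k\<in>{n..}. A k) < e"
proof -
  have "decseq (\<lambda>n. \<Union>k\<in>{n..}. A k)"
    unfolding decseq_def by (intro allI impI UN_mono) auto
  then have "(INF n. emeasure M (\<Union>k\<in>{n..}. A k)) = emeasure M (\<Inter>n. \<Union>k\<in>{n..}. A k)"
    using A by (intro INF_emeasure_decseq') auto
  also have "(\<Inter>n. \<Union>k\<in>{n..}. A k) = limsup A"
    by (simp add: limsup_INF_SUP)
  finally have "(INF n. emeasure M (\<Union>k\<in>{n..}. A k)) = 0"
    using assms(2) by (simp add: null_sets_def)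
  with assms(3) show ?thesis by (auto simp: Inf_image_eq_0_iff)
qed

section \<open>The implications between the hyperfiniteness conditions\<close>

context lifted_graph
begin

lemma edge_boundary_borel_sym:
  assumes "V \<in> sets borel" shows "edge_boundary G V \<in> sets borel" "sym (edge_boundary G V)"
  using assms sym_G borel_G
  by (auto simp: edge_boundary_def sym_def intro!: sets.Int sets.Un borel_Times)

text \<open>\<open>P\<close> stands for either kind of vertex cut. For cuts of summable measures the
  limit superior is null, so the edges meeting it are null for the lift, and the tail unions of the
  edge boundaries have measures tending to 0.\<close>

lemma small_edge_boundary:
  assumes "\<And>e. 0 < e \<Longrightarrow> \<exists>V\<in>sets borel. P V \<and> emeasure \<mu> V < e" and "0 < e"
  shows "\<exists>V\<in>sets borel. P V \<and> emeasure m (edge_boundary G V) < e"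
proof -
  have "\<exists>V\<in>sets borel. P V \<and> emeasure \<mu> V < ennreal ((1/2) ^ n)" for n :: nat
    by (intro assms(1)) simp
  then obtain V where V: "\<And>n. V n \<in> sets borel" "\<And>n. P (V n)"
      "\<And>n::nat. emeasure \<mu> (V n) < ennreal ((1/2) ^ n)"
    by metis
  let ?Z = "limsup V"
  have "?Z \<in> null_sets \<mu>"
    using V by (intro prob_space.finite_measure[OF prob_space_axioms, THEN finite_measure.limsup_null])
      (auto simp: sets_\<mu>)
  then have Z: "negl ?Z" by (rule null_sets_completionI)
  let ?H = "\<lambda>n. edge_boundary G (V n)"
  have H: "?H n \<in> sets m" for n
    using edge_boundary_borel_sym[OF V(1)] by (simp add: sets_m)
  \<comment> \<open>An edge meets infinitely many \<open>V n\<close> exactly if one of its two ends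
    lies in infinitely many of them.\<close>
  have lim_iff: "(x, y) \<in> limsup ?H \<longleftrightarrow> (x, y) \<in> G \<and> (x \<in> ?Z \<or> y \<in> ?Z)" for x y
    unfolding mem_limsup_iff by (simp add: edge_boundary_def frequently_disj_iff)
  have "limsup ?H \<in> sets m"
    using H unfolding limsup_INF_SUP by auto
  then have "borel_graph (limsup ?H)"
    unfolding borel_graph_def using sym_G lim_iff by (auto simp: sets_m sym_def)
  moreover have "limsup ?H \<subseteq> G" using lim_iff by auto
  moreover have "negl (fst ` limsup ?H)"
  proof (rule negl_subset[OF null_sets.Un[OF Z negl_neighbours[OF Z]]])
    show "fst ` limsup ?H \<subseteq> ?Z \<union> G `` ?Z"
    proof clarify
      fix x y assume "(x, y) \<in> limsup ?H" "fst (x, y) \<notin> G `` ?Z"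
      then show "fst (x, y) \<in> ?Z"
        using lim_iff sym_G by (auto dest: symD)
    qed
  qed
  ultimately have "limsup ?H \<in> null_sets m"
    using lift \<open>limsup ?H \<in> sets m\<close> by (auto simp: null_sets_def)
  from finite_measure.emeasure_tail_less[OF fm H this assms(2)] obtain n
    where n: "emeasure m (\<Union>k\<in>{n..}. ?H k) < e" by blast
  have "emeasure m (?H n) \<le> emeasure m (\<Union>k\<in>{n..}. ?H k)"
    using H by (intro emeasure_mono) auto
  with n V show ?thesis by (meson le_less_trans)
qed

lemma hvp_0_imp_hep_0:
  assumes "hvp \<mu> G = 0" shows "hep m G = 0"
  unfolding hep_def Inf_image_eq_0_iff
proof safe
  fix e :: ennreal assume "0 < e"
  have "\<exists>V\<in>sets borel. hyperfinitizing_vertex_cut G V \<and> emeasure \<mu> V < e" if "0 < e" for e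
    using assms that by (auto simp: hvp_def Inf_image_eq_0_iff)
  from small_edge_boundary[OF this \<open>0 < e\<close>] obtain V where
    V: "V \<in> sets borel" "hyperfinitizing_vertex_cut G V" "emeasure m (edge_boundary G V) < e"
    by blast
  then have "hyperfinitizing_edge_cut G (edge_boundary G V)"
    using edge_boundary_borel_sym[OF V(1)]
    by (simp add: hyperfinitizing_edge_cut_def hyperfinitizing_vertex_cut_def Diff_edge_boundary)
      (simp add: edge_boundary_def)
  with V edge_boundary_borel_sym[OF V(1)]
  show "\<exists>H\<in>{H \<in> sets borel. hyperfinitizing_edge_cut G H}. emeasure m H < e" by blast
qed

lemma fvp_0_imp_fep_0:
  assumes "fvp \<mu> G = 0" shows "fep m G = 0"
  unfolding fep_def Inf_image_eq_0_iff
proof safe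
  fix e :: ennreal assume "0 < e"
  have "\<exists>V\<in>sets borel. finitizing_vertex_cut G V \<and> emeasure \<mu> V < e" if "0 < e" for e
    using assms that by (auto simp: fvp_def Inf_image_eq_0_iff)
  from small_edge_boundary[OF this \<open>0 < e\<close>] obtain V where
    V: "V \<in> sets borel" "finitizing_vertex_cut G V" "emeasure m (edge_boundary G V) < e"
    by blast
  then have "finitizing_edge_cut G (edge_boundary G V)"
    using edge_boundary_borel_sym[OF V(1)]
    by (simp add: finitizing_edge_cut_def finitizing_vertex_cut_def Diff_edge_boundary)
      (simp add: edge_boundary_def)
  with V edge_boundary_borel_sym[OF V(1)]
  show "\<exists>H\<in>{H \<in> sets borel. finitizing_edge_cut G H}. emeasure m H < e" by blast
qed

text \<open>The enlarged cuts \<open>H' n\<close> decrease to \<open>H\<close>, because the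
  relations \<open>F n\<close> exhaust all edges of \<open>G - H\<close>. Continuity from above
  keeps the measure of some \<open>H' n\<close> below the bound already met by
  \<open>H\<close>.\<close>

lemma hep_0_imp_fep_0:
  assumes "hep m G = 0" shows "fep m G = 0"
  unfolding fep_def Inf_image_eq_0_iff
proof safe
  fix e :: ennreal assume "0 < e"
  with assms obtain H where H: "H \<in> sets borel" "hyperfinitizing_edge_cut G H" "emeasure m H < e"
    by (auto simp: hep_def Inf_image_eq_0_iff)
  then obtain F :: "nat \<Rightarrow> ('a \<times> 'a) set" where F: "incseq F" "\<And>n. equiv UNIV (F n)" "\<And>n. F n \<in> sets borel"
      "\<And>n x. finite (F n `` {x})" "(\<Union>n. F n) = conn_rel (G - H)"
    by (auto simp: hyperfinitizing_edge_cut_def hyperfinite_graph_def hyperfinite_on_def)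
  have sH: "sym H" "H \<subseteq> G" using H(2) by (auto simp: hyperfinitizing_edge_cut_def)
  define H' where "H' n = H \<union> (G - F n)" for n
  have H': "H' n \<in> sets m" for n
    using H F borel_G by (auto simp: H'_def sets_m)
  have "decseq H'"
    using F(1) by (auto simp: H'_def decseq_def incseq_def)
  then have "(INF n. emeasure m (H' n)) = emeasure m (\<Inter>n. H' n)"
    using H' emeasure_finite by (intro INF_emeasure_decseq') auto
  also have "(\<Inter>n. H' n) = H"
  proof -
    have "G - H \<subseteq> (\<Union>n. F n)" by (auto simp: F(5) conn_rel_def)
    then show ?thesis by (auto simp: H'_def)
  qed
  finally have "(INF n. emeasure m (H' n)) < e" using H(3) by simp
  then obtain n where n: "emeasure m (H' n) < e" by (auto simp: INF_less_iff)
  have "component_finite (G - H' n)"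
    by (rule component_finite_subset_equiv[OF F(2)[of n]]) (auto simp: H'_def F(4))
  moreover have "sym (H' n)"
  proof -
    have "sym (F n)" using F(2) by (rule equivE)
    then show ?thesis
      using sym_G sH(1) by (auto simp: H'_def sym_def)
  qed
  ultimately have "finitizing_edge_cut G (H' n)"
    using sH(2) unfolding finitizing_edge_cut_def H'_def by blast
  moreover have "H' n \<in> sets borel" using H'[of n] by (simp only: sets_m)
  ultimately show "\<exists>H\<in>{H \<in> sets borel. finitizing_edge_cut G H}. emeasure m H < e"
    using n by blast
qed

lemma fep_0_imp_mu_hyperfinite:
  assumes "fep m G = 0" shows "mu_hyperfinite \<mu> G"
proof -
  have "\<exists>H\<in>sets borel. finitizing_edge_cut G H \<and> emeasure m H < ennreal ((1/2) ^ n)" for n :: nat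
  proof -
    have "\<forall>e>0. \<exists>H\<in>{H \<in> sets borel. finitizing_edge_cut G H}. emeasure m H < e"
      using assms by (simp add: fep_def Inf_image_eq_0_iff)
    then have "\<exists>H\<in>{H \<in> sets borel. finitizing_edge_cut G H}. emeasure m H < ennreal ((1/2) ^ n)"
      by (elim allE[of _ "ennreal ((1/2) ^ n)"] impE) simp_all
    then show ?thesis by blast
  qed
  then obtain H where H: "\<And>n. H n \<in> sets borel" "\<And>n. finitizing_edge_cut G (H n)"
      "\<And>n::nat. emeasure m (H n) < ennreal ((1/2) ^ n)"
    by metis
  have H': "\<And>n. sym (H n)" "\<And>n. H n \<subseteq> G" "\<And>n. component_finite (G - H n)"
    using H(2) by (auto simp: finitizing_edge_cut_def)
  have lim0: "limsup H \<in> null_sets m"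
    using H by (intro finite_measure.limsup_null[OF fm]) (auto simp: sets_m)
  have "sym (limsup H)"
    using H'(1) by (auto simp: sym_def mem_limsup_iff elim!: frequently_elim1)
  moreover have "limsup H \<subseteq> G"
  proof
    fix p assume "p \<in> limsup H"
    then obtain n where "p \<in> H n" by (auto simp: mem_limsup_iff dest!: frequently_ex)
    then show "p \<in> G" using H'(2) by blast
  qed
  ultimately have lim: "negl (fst ` limsup H)"
    using lim0 lift[of "limsup H"] by (auto simp: null_sets_def borel_graph_def sets_m)
  \<comment> \<open>\<open>K n\<close> increases with \<open>n\<close> and is contained in
    \<open>G - H n\<close>, so its components are finite.\<close>
  define K where "K n = G - (\<Union>k\<in>{n..}. H k)" for n
  have K_inc: "incseq K"
    unfolding K_def incseq_def by (intro allI impI Diff_mono UN_mono) auto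
  have K: "borel_graph (K n)" "K n \<subseteq> G" for n
  proof -
    have "sym (K n)"
      using H'(1) sym_G unfolding sym_def K_def by blast
    then show "borel_graph (K n)" "K n \<subseteq> G"
      using H(1) borel_G by (auto simp: K_def borel_graph_def)
  qed
  \<comment> \<open>The graphs \<open>Q n\<close> are introduced for the sake of Borel connectedness
    relations.\<close>
  have "\<exists>Q. sigma_compact Q \<and> Q \<subseteq> K n \<and> sym Q \<and> negl (fst ` (K n - Q))" for n
    by (rule sigma_compact_subgraph[OF K[of n]]) blast
  then obtain Q where Q: "\<And>n. sigma_compact (Q n)" "\<And>n. Q n \<subseteq> K n" "\<And>n. sym (Q n)"
      "\<And>n. negl (fst ` (K n - Q n))"
    by metis
  \<comment> \<open>Discarded are the vertices with an edge in infinitely many \<open>H n\<close>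
    and those that lose an edge in passing from some \<open>K n\<close> to
    \<open>Q n\<close>.\<close>
  have "negl (fst ` limsup H \<union> (\<Union>n. fst ` (K n - Q n)))"
    by (rule null_sets.Un[OF lim null_sets_UN[OF Q(4)]])
  from invariant_conull[OF this] obtain Y
    where Y: "Y \<in> sets borel" "emeasure \<mu> (- Y) = 0" "conn_rel G `` Y \<subseteq> Y"
      "Y \<inter> (fst ` limsup H \<union> (\<Union>n. fst ` (K n - Q n))) = {}" .
  have KQ: "(x, y) \<in> conn_rel (Q n)" if "x \<in> Y" "(x, y) \<in> conn_rel (K n)" for x y n
    by (rule conn_rel_sub_invariant[OF Y(3) K(2) _ that]) (use Y(4) in blast)
  have QK: "conn_rel (Q n) \<subseteq> conn_rel (K n)" for n
    by (rule conn_rel_mono[OF Q(2)])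
  define F where "F n = conn_rel (Q n) \<inter> Y \<times> Y" for n
  \<comment> \<open>The description by \<open>Q n\<close> shows that \<open>F n\<close> is Borel.
    The description by \<open>K n\<close> gives monotonicity, finite classes and exhaustion.\<close>
  have F_eq: "F n = conn_rel (K n) \<inter> Y \<times> Y" for n
    using KQ QK[of n] unfolding F_def by blast
  have "hyperfinite_on Y (conn_rel G \<inter> Y \<times> Y)"
    unfolding hyperfinite_on_def
  proof (intro exI[of _ F] conjI allI ballI)
    show "incseq F"
      unfolding F_eq by (intro monoI Int_mono conn_rel_mono incseqD[OF K_inc] order_refl)
    show "equiv Y (F n)" for n
      unfolding F_def by (rule equiv_restrict[OF equiv_conn_rel[OF Q(3)]])
    show "F n \<in> sets borel" for n
      unfolding F_def using Y(1) borel_conn_rel[OF Q(1)] by (intro sets.Int borel_Times) auto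
    show "finite (F n `` {x})" for n x
    proof -
      have "component_finite (K n)"
        by (rule component_finite_subset[OF H'(3)[of n]]) (auto simp: K_def)
      then have "finite (conn_rel (K n) `` {x})" by (simp add: component_finite_def)
      then show ?thesis by (rule rev_finite_subset) (auto simp: F_eq)
    qed
    show "(\<Union>n. F n) = conn_rel G \<inter> Y \<times> Y"
    proof
      show "(\<Union>n. F n) \<subseteq> conn_rel G \<inter> Y \<times> Y"
        using conn_rel_mono[OF K(2)] by (auto simp: F_eq)
      show "conn_rel G \<inter> Y \<times> Y \<subseteq> (\<Union>n. F n)"
      proof clarify
        fix x y assume xy: "(x, y) \<in> conn_rel G" "x \<in> Y" "y \<in> Y"
        have "\<exists>n. (a, b) \<in> K n" if "a \<in> Y" "(a, b) \<in> G" for a b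
        proof -
          have "(a, b) \<notin> limsup H" using Y(4) that(1) by force
          then show ?thesis
            using that(2) by (auto simp: mem_limsup_iff K_def frequently_sequentially)
        qed
        from conn_rel_incseq_UN[OF K_inc xy(1) Y(3) xy(2) this] xy(2,3)
        show "(x, y) \<in> (\<Union>n. F n)" by (auto simp: F_eq)
      qed
    qed
  qed
  with Y show ?thesis unfolding mu_hyperfinite_def by blast
qed

text \<open>The null set \<open>- Y\<close> is itself a hyperfinitizing vertex cut: without it, the
  connectedness relation is the union of the \<open>F n\<close> together with the diagonal.\<close>

lemma mu_hyperfinite_imp_hvp_0:
  assumes "mu_hyperfinite \<mu> G" shows "hvp \<mu> G = 0"
proof -
  obtain Y F
    where Y: "Y \<in> sets borel" "emeasure \<mu> (- Y) = 0" "conn_rel G `` Y \<subseteq> Y"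
      and F: "incseq F" "\<And>n. equiv Y (F n)" "\<And>n. F n \<in> sets borel"
        "\<And>n x. x \<in> Y \<Longrightarrow> finite (F n `` {x})" "(\<Union>n. F n) = conn_rel G \<inter> Y \<times> Y"
    by (rule mu_hyperfiniteE[OF assms(1)], rule that)
  have "conn_rel (G \<inter> Y \<times> Y) = (\<Union>n. F n) \<union> Id"
  proof
    show "conn_rel (G \<inter> Y \<times> Y) \<subseteq> (\<Union>n. F n) \<union> Id"
    proof (rule conn_rel_subset_equiv)
      show "equiv Y (\<Union>n. F n)"
        unfolding F(5) by (rule equiv_restrict[OF equiv_conn_rel[OF sym_G]])
      show "G \<inter> Y \<times> Y \<subseteq> (\<Union>n. F n)"
        unfolding F(5) by (auto simp: conn_rel_def)
    qed
    have "(x, y) \<in> conn_rel (G \<inter> Y \<times> Y)" if "x \<in> Y" "(x, y) \<in> conn_rel G" for x y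
    proof (rule conn_rel_sub_invariant[OF Y(3) order_refl _ that])
      have "G `` Y \<subseteq> Y" using Y(3) by (auto simp: conn_rel_def)
      then show "Y \<inter> fst ` (G - G \<inter> Y \<times> Y) = {}" by fastforce
    qed
    then show "(\<Union>n. F n) \<union> Id \<subseteq> conn_rel (G \<inter> Y \<times> Y)"
      by (auto simp: F(5)) (simp add: conn_rel_def)
  qed
  moreover have "hyperfinite_on UNIV ((\<Union>n. F n) \<union> Id)"
    unfolding hyperfinite_on_def
  \<comment> \<open>Adding the diagonal extends the relations from \<open>Y\<close> to the whole
    space, with singleton classes outside \<open>Y\<close>.\<close>
  proof (intro exI[of _ "\<lambda>n. F n \<union> Id"] conjI allI ballI)
    show "incseq (\<lambda>n. F n \<union> Id)" using F(1) by (auto simp: incseq_def)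
    show "equiv UNIV (F n \<union> Id)" for n
    proof (rule equivI)
      show "sym (F n \<union> Id)" "trans (F n \<union> Id)"
        using F(2)[of n] by (auto simp: equiv_def intro!: symI transI dest: symD transD)
    qed (auto simp: refl_on_def)
    show "F n \<union> Id \<in> sets borel" for n
      using F(3) borel_closed[OF closed_Id] by (rule sets.Un)
    show "finite ((F n \<union> Id) `` {x})" for n x
      using finite_equiv_Image[OF F(2,4)] by (simp add: Un_Image)
  qed auto
  ultimately have "hyperfinitizing_vertex_cut G (- Y)"
    by (simp add: hyperfinitizing_vertex_cut_def hyperfinite_graph_def)
  then have "hvp \<mu> G \<le> emeasure \<mu> (- Y)"
    unfolding hvp_def using Y(1) by (intro INF_lower) auto
  with Y(2) show ?thesis by simp
qed

text \<open>Deleting the vertices with an edge outside \<open>F n\<close> leaves a subgraph of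
  \<open>F n\<close>. By local finiteness a vertex of \<open>Y\<close> is of this kind for only
  finitely many \<open>n\<close>, so the measures of these cuts become arbitrarily small.\<close>

lemma mu_hyperfinite_imp_fvp_0:
  assumes "mu_hyperfinite \<mu> G" and lf: "locally_finite_graph G" shows "fvp \<mu> G = 0"
proof -
  obtain Y F
    where Y: "Y \<in> sets borel" "emeasure \<mu> (- Y) = 0" "conn_rel G `` Y \<subseteq> Y"
      and F: "incseq F" "\<And>n. equiv Y (F n)" "\<And>n. F n \<in> sets borel"
        "\<And>n x. x \<in> Y \<Longrightarrow> finite (F n `` {x})" "(\<Union>n. F n) = conn_rel G \<inter> Y \<times> Y"
    by (rule mu_hyperfiniteE[OF assms(1)], rule that)
  have R: "borel_graph (G - F n)" for n
  proof -
    have "sym (F n)" using F(2) by (rule equivE)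
    then show ?thesis
      using F(3)[of n] sym_G borel_G by (auto simp: borel_graph_def sym_def)
  qed
  have "\<exists>Q. sigma_compact Q \<and> Q \<subseteq> G - F n \<and> negl (fst ` (G - F n - Q))" for n
    by (rule sigma_compact_subgraph[OF R[of n] Diff_subset]) blast
  then obtain Q where Q: "\<And>n. sigma_compact (Q n)" "\<And>n. Q n \<subseteq> G - F n" "\<And>n. negl (fst ` (G - F n - Q n))"
    by metis
  have "negl (\<Union>n. fst ` (G - F n - Q n))" using Q(3) by (rule null_sets_UN)
  then obtain Z where Z: "Z \<in> sets borel" "emeasure \<mu> Z = 0" "(\<Union>n. fst ` (G - F n - Q n)) \<subseteq> Z"
    by (auto simp: negl_iff)
  \<comment> \<open>\<open>W n\<close> is a Borel set covering the vertices with an edge outside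
    \<open>F n\<close>. The null set \<open>Z\<close> absorbs what the sigma-compact approximations
    \<open>Q n\<close> miss.\<close>
  define W where "W n = fst ` Q n \<union> Z" for n
  have W: "W n \<in> sets \<mu>" for n
    unfolding W_def sets_\<mu> using Z(1) Q(1)
    by (intro sets.Un sigma_compact_borel[OF sigma_compact_image] continuous_intros)
  have RW: "fst ` (G - F n) \<subseteq> W n" for n
    using Z(3) by (force simp: W_def)
  have lim_sub: "limsup W \<subseteq> - Y \<union> Z"
  proof (rule subsetI, rule ccontr)
    fix x assume x: "x \<in> limsup W" "x \<notin> - Y \<union> Z"
    then have "\<exists>\<^sub>F n in sequentially. x \<in> fst ` (G - F n)"
      using Q(2) by (auto simp: mem_limsup_iff W_def elim!: frequently_elim1)
    \<comment> \<open>Finiteness of the neighbourhood of \<open>x\<close> allows one index to serve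
      all its edges.\<close>
    moreover have "\<forall>\<^sub>F n in sequentially. \<forall>y\<in>G `` {x}. (x, y) \<in> F n"
    proof (rule eventually_ball_finite)
      show "finite (G `` {x})" using lf by (simp add: locally_finite_graph_def)
      show "\<forall>y\<in>G `` {x}. \<forall>\<^sub>F n in sequentially. (x, y) \<in> F n"
      proof
        fix y assume "y \<in> G `` {x}"
        then have "(x, y) \<in> conn_rel G" by (auto simp: conn_rel_def)
        with x(2) Y(3) have "(x, y) \<in> (\<Union>n. F n)" unfolding F(5) by blast
        then obtain n where "(x, y) \<in> F n" by blast
        then show "\<forall>\<^sub>F n in sequentially. (x, y) \<in> F n"
          using incseqD[OF F(1)] by (auto simp: eventually_sequentially)
      qed
    qed
    ultimately have "\<exists>\<^sub>F n in sequentially. x \<in> fst ` (G - F n) \<and> (\<forall>y\<in>G `` {x}. (x, y) \<in> F n)"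
      by (rule frequently_eventually_frequently)
    then obtain n where "x \<in> fst ` (G - F n)" "\<forall>y\<in>G `` {x}. (x, y) \<in> F n"
      by (blast dest: frequently_ex)
    then show False by auto
  qed
  have "- Y \<union> Z \<in> null_sets \<mu>"
    using Y Z by (intro null_sets.Un) (auto simp: null_sets_def sets_\<mu>)
  then have lim: "limsup W \<in> null_sets \<mu>"
    by (rule null_sets_subset[OF _ _ lim_sub]) (use W in \<open>auto simp: limsup_INF_SUP\<close>)
  have \<mu>_fm: "finite_measure \<mu>" by (rule prob_space.finite_measure[OF prob_space_axioms])
  show ?thesis
    unfolding fvp_def Inf_image_eq_0_iff
  proof safe
    fix e :: ennreal assume "0 < e"
    from finite_measure.emeasure_tail_less[OF \<mu>_fm W lim this] obtain n
      where n: "emeasure \<mu> (\<Union>k\<in>{n..}. W k) < e" by blast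
    have "emeasure \<mu> (W n) \<le> emeasure \<mu> (\<Union>k\<in>{n..}. W k)"
      using W by (intro emeasure_mono) auto
    with n have "emeasure \<mu> (W n) < e" by (rule le_less_trans[rotated])
    moreover have "finitizing_vertex_cut G (W n)"
      unfolding finitizing_vertex_cut_def
    proof (rule component_finite_subset_equiv[OF F(2,4)])
      show "G \<inter> (- W n) \<times> (- W n) \<subseteq> F n" using RW[of n] by force
    qed
    ultimately show "\<exists>V\<in>{V \<in> sets borel. finitizing_vertex_cut G V}. emeasure \<mu> V < e"
      using W[of n] by (auto simp: sets_\<mu>)
  qed
qed

end

section \<open>Transport of the lift and conclusion\<close>

text \<open>The identity, read as the inclusion of \<open>G\<close>, pushes the lift forward to the
  product space, where inner regularity is available. Values on Borel subsets of \<open>G\<close>,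
  and with them the lift property, are unchanged.\<close>

lemma lifted_graph_distr:
  fixes \<mu> :: "'a::polish_space measure"
  assumes "prob_space \<mu>" "sets \<mu> = sets borel" "borel_graph G" "locally_countable_graph G"
    "quasi_pmp \<mu> G" "finite_measure \<nu>" "is_lift \<mu> G \<nu>"
  defines "m \<equiv> distr \<nu> borel (\<lambda>p. p)"
  shows "lifted_graph \<mu> m G" and "\<And>H. H \<in> sets borel \<Longrightarrow> H \<subseteq> G \<Longrightarrow> emeasure m H = emeasure \<nu> H"
proof -
  have G: "G \<in> sets borel" using assms(3) by (simp add: borel_graph_def)
  have sets_\<nu>: "sets \<nu> = sets (restrict_space borel G)"
    using assms(7) by (simp add: is_lift_def borel_measure_on_def)
  have sp: "space \<nu> = G"
    using sets_eq_imp_space_eq[OF sets_\<nu>] by (simp add: space_restrict_space)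
  have id: "(\<lambda>p. p) \<in> \<nu> \<rightarrow>\<^sub>M borel"
    unfolding measurable_cong_sets[OF sets_\<nu> refl] by (rule measurable_restrict_space1) simp
  show em: "emeasure m H = emeasure \<nu> H" if "H \<in> sets borel" "H \<subseteq> G" for H
    using that by (simp add: m_def emeasure_distr[OF id] sp Int_absorb2 vimage_def)
  have sub: "H \<in> sets \<nu>" if "H \<in> sets borel" "H \<subseteq> G" for H
    using that G by (simp add: sets_\<nu> sets_restrict_space_iff)
  interpret \<mu>: prob_space \<mu> by fact
  interpret m: finite_measure m
    unfolding m_def using assms(6) id by (rule finite_measure.finite_measure_distr)
  show "lifted_graph \<mu> m G"
  proof
    show "sets m = sets borel" by (simp add: m_def)
    fix H assume H: "borel_graph H" "H \<subseteq> G"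
    then have "H \<in> null_sets \<nu> \<longleftrightarrow> fst ` H \<in> null_sets (completion \<mu>)"
      using assms(7) by (simp add: is_lift_def)
    moreover have "H \<in> sets borel" using H(1) by (simp add: borel_graph_def)
    ultimately show "emeasure m H = 0 \<longleftrightarrow> fst ` H \<in> null_sets (completion \<mu>)"
      using em sub H(2) by (simp add: null_sets_def)
  qed fact+
qed

theorem proposition6p5:
  fixes \<mu> :: "'a::polish_space measure"
    and G :: "('a \<times> 'a) set"
    and \<mu>hat :: "('a \<times> 'a) measure"
  assumes "prob_space \<mu>" and "sets \<mu> = sets borel"
    and "borel_graph G" and "locally_countable_graph G" and "quasi_pmp \<mu> G"
    and "finite_measure \<mu>hat" and "is_lift \<mu> G \<mu>hat"
  shows "(mu_hyperfinite \<mu> G \<longleftrightarrow> hvp \<mu> G = 0)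
    \<and> (hvp \<mu> G = 0 \<longleftrightarrow> hep \<mu>hat G = 0)
    \<and> (hep \<mu>hat G = 0 \<longleftrightarrow> fep \<mu>hat G = 0)
    \<and> (fvp \<mu> G = 0 \<longrightarrow> mu_hyperfinite \<mu> G)
    \<and> (locally_finite_graph G \<longrightarrow> (fvp \<mu> G = 0 \<longleftrightarrow> mu_hyperfinite \<mu> G))"
proof -
  define m where "m = distr \<mu>hat borel (\<lambda>p. p)"
  note * = lifted_graph_distr[OF assms, folded m_def]
  interpret lifted_graph \<mu> m G by (rule *(1))
  have eqs: "hep \<mu>hat G = hep m G" "fep \<mu>hat G = fep m G"
    unfolding hep_def fep_def
    by (auto intro!: INF_cong simp: *(2) hyperfinitizing_edge_cut_def finitizing_edge_cut_def)
  \<comment> \<open>\<open>A\<close> stands for \<mu>-hyperfiniteness, \<open>B\<close> to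
    \<open>E\<close> for the vanishing of \<open>hvp\<close>, \<open>hep\<close>, \<open>fep\<close>
    and \<open>fvp\<close>, and \<open>F\<close> for local finiteness.\<close>
  have cycle: "(A \<longleftrightarrow> B) \<and> (B \<longleftrightarrow> C) \<and> (C \<longleftrightarrow> D) \<and> (E \<longrightarrow> A) \<and> (F \<longrightarrow> (E \<longleftrightarrow> A))"
    if "A \<Longrightarrow> B" "B \<Longrightarrow> C" "C \<Longrightarrow> D" "D \<Longrightarrow> A" "E \<Longrightarrow> D" "A \<Longrightarrow> F \<Longrightarrow> E" for A B C D E F
    using that by blast
  show ?thesis
    unfolding eqs
    by (rule cycle[OF mu_hyperfinite_imp_hvp_0 hvp_0_imp_hep_0 hep_0_imp_fep_0
          fep_0_imp_mu_hyperfinite fvp_0_imp_fep_0 mu_hyperfinite_imp_fvp_0])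
qed

end
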